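(* Let $L \in K[\partial_t,\partial_{x_1},\dots,\partial_{x_n}]$ and let $\psi \in \ker L$, $\psi\neq 0$. The operator $M = \partial_t-\psi_t \psi^{-1}$ generates a Darboux transformation of $L$ (i.e. there exist operators $N, L_1$ such that $(M,N)\colon L\to L_1$ is a Darboux transformation) if and only if there exist some $A \in K[\partial_t,\partial_{x_1},\dots,\partial_{x_n}]$, a $t$-free $B \in K[\partial_t,\partial_{x_1},\dots,\partial_{x_n}]$ and a nonzero $c\in K$ such that $$L^{\psi} = A \partial_t + c B .$$ Here either $B = 0$, or any one non-zero coefficient in $B$ may be taken to be $1$. If the Darboux transformation exists, then $L_1$ and $N$ are given by $$L_1^{\psi} = L^{\psi} - A \partial_t +N^{\psi}A,\qquad N^\psi = \partial_t^{1/c}.$$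
   Context: $K$ is a differential field of characteristic zero with commuting derivations $\partial_t,\partial_{x_1},\dots,\partial_{x_n}$ ($t$ is a distinguished variable), and $K[\partial_t,\partial_{x_1},\dots,\partial_{x_n}]$ is the ring of linear partial differential operators over $K$. Standing convention: either $K$ is differentially closed, or $K$ is assumed to contain the solutions of the partial differential equations encountered. Elements of $K$ are called functions. $\ker L$ is the set of $\phi\in K$ with $L[\phi]=0$. $\sigma(L)$ denotes the principal symbol of $L$. A Darboux transformation $(M,N)\colon L\to L_1$, where $\sigma(L)=\sigma(L_1)$, is a pair of operators $(M,N)$ satisfying $NL=L_1M$. For a nonzero $g\in K$ and an operator $P$, $P^{g}=g^{-1}Pg$ (product of operators); in particular $\partial_t^{1/c}=c\,\partial_t\,(1/c)$. An operator is $t$-free if it does not contain $\partial_t$ and none of its coefficients depend on $t$ (i.e. each coefficient is annihilated by $\partial_t$). $\psi_t=\partial_t[\psi]$. *)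

theory Defs
  imports Complex_Main "HOL-Library.Poly_Mapping"
begin

abbreviation lookup :: "('a \<Rightarrow>\<^sub>0 'b::zero) \<Rightarrow> 'a \<Rightarrow> 'b" where
  "lookup \<equiv> Poly_Mapping.lookup"

abbreviation keys :: "('a \<Rightarrow>\<^sub>0 'b::zero) \<Rightarrow> 'a set" where
  "keys \<equiv> Poly_Mapping.keys"

text \<open>
  The differential field is a type \<open>'k\<close> of class \<^class>\<open>field_char_0\<close> together with one derivation
  \<open>D v\<close> for each element \<open>v\<close> of a finite type \<open>'v\<close> of variables. The distinguished variable \<open>t\<close> is
  an element of \<open>'v\<close>, and the remaining elements are \<open>x\<^sub>1, \<dots>, x\<^sub>n\<close>.
\<close>

locale partial_differential_field =
  fixes D :: "'v::finite \<Rightarrow> 'k::field_char_0 \<Rightarrow> 'k"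
  assumes D_add: "D v (a + b) = D v a + D v b"
    and D_mult: "D v (a * b) = D v a * b + a * D v b"
    and D_commute: "D v (D w a) = D w (D v a)"

text \<open>
  An operator is a formal finite sum \<open>\<Sum>\<^sub>\<alpha> a\<^sub>\<alpha> \<partial>\<^sup>\<alpha>\<close>, represented by its coefficients. Sums and
  differences are those of \<^theory>\<open>HOL-Library.Poly_Mapping\<close>. Its \<open>*\<close> is the commutative product of
  polynomials and is not the product of operators, which is \<open>op_mult\<close> below. The principal symbol is
  a polynomial in commuting variables, and so it lives in the same type.
\<close>

type_synonym 'v mindex = "'v \<Rightarrow>\<^sub>0 nat"
type_synonym ('v, 'k) pdo = "'v mindex \<Rightarrow>\<^sub>0 'k"

definition mdeg :: "'v mindex \<Rightarrow> nat" where
  "mdeg \<alpha> = (\<Sum>v\<in>keys \<alpha>. lookup \<alpha> v)"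

text \<open>
  The componentwise order, not \<open>\<le>\<close>, which is lexicographic on \<open>\<Rightarrow>\<^sub>0\<close>.
\<close>

definition sub_index :: "'v mindex \<Rightarrow> 'v mindex \<Rightarrow> bool" where
  "sub_index \<gamma> \<alpha> \<longleftrightarrow> (\<forall>v. lookup \<gamma> v \<le> lookup \<alpha> v)"

definition mbinom :: "'v mindex \<Rightarrow> 'v mindex \<Rightarrow> nat" where
  "mbinom \<alpha> \<gamma> = (\<Prod>v\<in>keys \<alpha>. lookup \<alpha> v choose lookup \<gamma> v)"

text \<open>
  The function \<open>\<partial>\<^sup>\<alpha>[f]\<close>. The fold does not depend on the order of the variables because the
  derivations commute.
\<close>

definition deriv_pow :: "('v \<Rightarrow> 'k \<Rightarrow> 'k) \<Rightarrow> 'v mindex \<Rightarrow> 'k \<Rightarrow> 'k" where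
  "deriv_pow D \<alpha> f = Finite_Set.fold (\<lambda>v. (D v) ^^ (lookup \<alpha> v)) f (keys \<alpha>)"

definition op_apply :: "('v \<Rightarrow> 'k \<Rightarrow> 'k) \<Rightarrow> ('v, 'k::comm_ring_1) pdo \<Rightarrow> 'k \<Rightarrow> 'k" where
  "op_apply D L \<phi> = (\<Sum>\<alpha>\<in>keys L. lookup L \<alpha> * deriv_pow D \<alpha> \<phi>)"

definition op_ker :: "('v \<Rightarrow> 'k \<Rightarrow> 'k) \<Rightarrow> ('v, 'k::comm_ring_1) pdo \<Rightarrow> 'k set" where
  "op_ker D L = {\<phi>. op_apply D L \<phi> = 0}"

text \<open>
  The product is the biadditive extension of the Leibniz rule
  \<open>(a \<partial>\<^sup>\<alpha>) (b \<partial>\<^sup>\<beta>) = (\<Sum>\<gamma>\<le>\<alpha>. (\<alpha> choose \<gamma>) a \<partial>\<^sup>\<gamma>[b] \<partial>\<^sup>\<alpha>\<^sup>-\<^sup>\<gamma>\<^sup>+\<^sup>\<beta>)\<close>.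
\<close>

definition op_mult ::
    "('v \<Rightarrow> 'k \<Rightarrow> 'k) \<Rightarrow> ('v, 'k::comm_ring_1) pdo \<Rightarrow> ('v, 'k) pdo \<Rightarrow> ('v, 'k) pdo" where
  "op_mult D P Q =
     (\<Sum>\<alpha>\<in>keys P. \<Sum>\<beta>\<in>keys Q. \<Sum>\<gamma> | sub_index \<gamma> \<alpha>.
        Poly_Mapping.single (\<alpha> - \<gamma> + \<beta>)
          (of_nat (mbinom \<alpha> \<gamma>) * lookup P \<alpha> * deriv_pow D \<gamma> (lookup Q \<beta>)))"

definition fun_op :: "'k::comm_ring_1 \<Rightarrow> ('v, 'k) pdo" where
  "fun_op f = Poly_Mapping.single 0 f"

definition der_op :: "'v \<Rightarrow> ('v, 'k::comm_ring_1) pdo" where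
  "der_op v = Poly_Mapping.single (Poly_Mapping.single v 1) 1"

text \<open>\<open>op_conj D g P\<close> is \<open>P\<^sup>g = g\<^sup>-\<^sup>1 P g\<close>.\<close>

definition op_conj :: "('v \<Rightarrow> 'k \<Rightarrow> 'k) \<Rightarrow> 'k \<Rightarrow> ('v, 'k::field) pdo \<Rightarrow> ('v, 'k) pdo" where
  "op_conj D g P = op_mult D (op_mult D (fun_op (inverse g)) P) (fun_op g)"

definition op_order :: "('v, 'k::zero) pdo \<Rightarrow> nat" where
  "op_order P = Max (insert 0 (mdeg ` keys P))"

definition symbol :: "('v, 'k::comm_ring_1) pdo \<Rightarrow> ('v mindex \<Rightarrow>\<^sub>0 'k)" where
  "symbol P = (\<Sum>\<alpha> | \<alpha> \<in> keys P \<and> mdeg \<alpha> = op_order P. Poly_Mapping.single \<alpha> (lookup P \<alpha>))"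

text \<open>\<open>darboux_transformation D M N L L1\<close> is \<open>(M, N): L \<rightarrow> L1\<close>.\<close>

definition darboux_transformation ::
    "('v \<Rightarrow> 'k \<Rightarrow> 'k) \<Rightarrow> ('v, 'k::comm_ring_1) pdo \<Rightarrow> ('v, 'k) pdo \<Rightarrow> ('v, 'k) pdo \<Rightarrow> ('v, 'k) pdo
      \<Rightarrow> bool" where
  "darboux_transformation D M N L L1 \<longleftrightarrow>
     symbol L = symbol L1 \<and> op_mult D N L = op_mult D L1 M"

definition t_free :: "('v \<Rightarrow> 'k \<Rightarrow> 'k) \<Rightarrow> 'v \<Rightarrow> ('v, 'k::comm_ring_1) pdo \<Rightarrow> bool" where
  "t_free D t B \<longleftrightarrow> (\<forall>\<alpha>\<in>keys B. lookup \<alpha> t = 0 \<and> D t (lookup B \<alpha>) = 0)"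

text \<open>The decomposition \<open>P = A \<partial>\<^sub>t + c B\<close> with \<open>B\<close> free of \<open>t\<close>.\<close>

definition t_decomposition ::
    "('v \<Rightarrow> 'k \<Rightarrow> 'k) \<Rightarrow> 'v \<Rightarrow> ('v, 'k::comm_ring_1) pdo \<Rightarrow> ('v, 'k) pdo \<Rightarrow> ('v, 'k) pdo \<Rightarrow> 'k
      \<Rightarrow> bool" where
  "t_decomposition D t P A B c \<longleftrightarrow>
     c \<noteq> 0 \<and> t_free D t B \<and>
     P = op_mult D A (der_op t) + op_mult D (fun_op c) B"

text \<open>
  The equations \<open>L1\<^sup>\<psi> = L\<^sup>\<psi> - A \<partial>\<^sub>t + N\<^sup>\<psi> A\<close> and \<open>N\<^sup>\<psi> = \<partial>\<^sub>t\<^sup>1\<^sup>/\<^sup>c\<close>.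
\<close>

definition darboux_formulas ::
    "('v \<Rightarrow> 'k \<Rightarrow> 'k) \<Rightarrow> 'v \<Rightarrow> 'k \<Rightarrow> ('v, 'k::field) pdo \<Rightarrow> ('v, 'k) pdo \<Rightarrow> 'k
      \<Rightarrow> ('v, 'k) pdo \<Rightarrow> ('v, 'k) pdo \<Rightarrow> bool" where
  "darboux_formulas D t \<psi> L A c N L1 \<longleftrightarrow>
     op_conj D \<psi> L1 = op_conj D \<psi> L - op_mult D A (der_op t) + op_mult D (op_conj D \<psi> N) A \<and>
     op_conj D \<psi> N = op_conj D (1 / c) (der_op t)"

text \<open>
  The form in which ``\<open>K\<close> contains the solutions of the equations encountered'' is needed: every
  equation \<open>\<partial>\<^sub>t[c] = b c\<close> has a nonzero solution. Every differentially closed field has this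
  property.
\<close>

definition has_exponential_solutions :: "('v \<Rightarrow> 'k::field \<Rightarrow> 'k) \<Rightarrow> 'v \<Rightarrow> bool" where
  "has_exponential_solutions D t \<longleftrightarrow> (\<forall>b. \<exists>c. c \<noteq> 0 \<and> D t c = b * c)"

end

theory Submission
  imports Defs
begin

text \<open>
  Conjugation by \<open>\<psi>\<close> is a ring automorphism that preserves principal symbols and turns \<open>M\<close> into \<open>\<partial>\<^sub>t\<close>.
  With \<open>P = L\<^sup>\<psi>\<close>, \<open>Q = L\<^sub>1\<^sup>\<psi>\<close> and \<open>N\<close> in place of \<open>N\<^sup>\<psi>\<close>, the question becomes when \<open>N P = Q \<partial>\<^sub>t\<close> for some
  \<open>N\<close> and some \<open>Q\<close> with the symbol of \<open>P\<close>.

  If \<open>P \<noteq> 0\<close>, then \<open>N = \<partial>\<^sub>t + f\<close> for a function \<open>f\<close>: since \<open>P\<close> and \<open>Q\<close> have the same symbol,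
  \<open>(N - \<partial>\<^sub>t) P\<close> has at most the order of \<open>P\<close>, and orders add up (\<open>intertwiner_first_order\<close>). Now divide by \<open>\<partial>\<^sub>t\<close>
  on the right, \<open>P = A \<partial>\<^sub>t + R\<close> where \<open>R\<close> does not contain \<open>\<partial>\<^sub>t\<close>. The product \<open>(\<partial>\<^sub>t + f) P\<close> has the
  quotient \<open>(\<partial>\<^sub>t + f) A + R\<close>, and its remainder arises from \<open>R\<close> by applying \<open>\<partial>\<^sub>t + f\<close> to the coefficients
  (\<open>intertwining_iff\<close>). So \<open>N P = Q \<partial>\<^sub>t\<close> means that \<open>Q\<close> is this quotient and that all coefficients
  of \<open>R\<close> solve \<open>\<partial>\<^sub>t[r] = - f r\<close>. A nonzero solution \<open>c\<close> of that equation makes \<open>R = c B\<close> with a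
  \<open>t\<close>-free \<open>B\<close>, and then \<open>\<partial>\<^sub>t + f = \<partial>\<^sub>t - c\<^sub>t / c = \<partial>\<^sub>t\<^sup>1\<^sup>/\<^sup>c\<close>. If \<open>R \<noteq> 0\<close>, any nonzero coefficient of \<open>R\<close> is such
  a \<open>c\<close>. If \<open>R = 0\<close>, the decomposition holds with \<open>B = 0\<close>, every \<open>f\<close> is possible, and only the
  formula for \<open>N\<close> asks for a solution \<open>c\<close>. Conversely, a decomposition with \<open>R = c B\<close> gives an
  intertwining operator \<open>\<partial>\<^sub>t\<^sup>1\<^sup>/\<^sup>c\<close>, and \<open>Q\<close> has the symbol of \<open>P\<close> because \<open>A\<close> has smaller order than \<open>P\<close>
  (\<open>symbol_intertwined\<close>).

  Underneath lies the algebra of operators. The Leibniz formula that defines their product is the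
  expansion of repeated left multiplication by the derivations (\<open>left_pow_single\<close>). Each step of it
  commutes with multiplication from the right (\<open>left_der_mult\<close>), so the product is associative
  (\<open>op_mult_assoc\<close>). Orders add up because in top degree the product is that of commuting polynomials (\<open>op_mult_approx\<close>), which have no
  zero divisors (\<open>times_top_coefficient\<close>).
\<close>

section \<open>Multi-indices\<close>

abbreviation unit_index :: "'v \<Rightarrow> 'v mindex" where
  "unit_index v \<equiv> Poly_Mapping.single v 1"

lemma mdeg_eq_sum_UNIV: "mdeg (\<alpha> :: 'v::finite mindex) = (\<Sum>v\<in>UNIV. lookup \<alpha> v)"
  unfolding mdeg_def by (rule sum.mono_neutral_left) (auto simp: in_keys_iff)

lemma mdeg_add: "mdeg (\<alpha> + \<beta> :: 'v::finite mindex) = mdeg \<alpha> + mdeg \<beta>"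
  by (simp add: mdeg_eq_sum_UNIV lookup_add sum.distrib)

lemma mdeg_eq_0_iff: "mdeg (\<alpha> :: 'v::finite mindex) = 0 \<longleftrightarrow> \<alpha> = 0"
  by (auto simp: mdeg_eq_sum_UNIV intro: poly_mapping_eqI)

lemma mdeg_unit_index: "mdeg (unit_index (v :: 'v::finite)) = 1"
  by (simp add: mdeg_def)

lemma unit_index_diff_add:
  assumes "lookup \<alpha> v \<noteq> 0"
  shows "\<alpha> - unit_index v + unit_index v = \<alpha>"
proof (rule poly_mapping_eqI)
  fix w show "lookup (\<alpha> - unit_index v + unit_index v) w = lookup \<alpha> w"
    using assms by (cases "w = v") (auto simp: lookup_add lookup_minus lookup_single)
qed

lemma mindex_induct [case_names zero step]:
  fixes \<alpha> :: "'v::finite mindex"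
  assumes zero: "P 0"
    and step: "\<And>\<alpha> v. P \<alpha> \<Longrightarrow> P (\<alpha> + unit_index v)"
  shows "P \<alpha>"
proof (induction "mdeg \<alpha>" arbitrary: \<alpha>)
  case 0
  then show ?case using zero by (simp add: mdeg_eq_0_iff)
next
  case (Suc n)
  then have "\<alpha> \<noteq> 0"
    by (metis mdeg_eq_0_iff nat.distinct(1))
  then obtain v where v: "lookup \<alpha> v \<noteq> 0"
    by (metis lookup_zero poly_mapping_eqI)
  have "mdeg \<alpha> = mdeg (\<alpha> - unit_index v) + 1"
    using mdeg_add[of "\<alpha> - unit_index v" "unit_index v"]
    by (simp del: One_nat_def add: unit_index_diff_add[OF v] mdeg_unit_index)
  then have "P (\<alpha> - unit_index v)"
    using Suc by simp
  from step[OF this, of v] show ?case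
    by (simp del: One_nat_def add: unit_index_diff_add[OF v])
qed

lemma sub_index_add_unit:
  "sub_index \<gamma> (\<alpha> + unit_index v) \<longleftrightarrow>
     sub_index \<gamma> \<alpha> \<or> lookup \<gamma> v \<noteq> 0 \<and> sub_index (\<gamma> - unit_index v) \<alpha>"
  (is "?l \<longleftrightarrow> ?r")
proof
  assume l: ?l
  show ?r
  proof (cases "lookup \<gamma> v \<le> lookup \<alpha> v")
    case True
    have "lookup \<gamma> w \<le> lookup \<alpha> w" for w
      using l True by (cases "w = v") (auto simp: sub_index_def lookup_add lookup_single dest: spec[of _ w])
    then show ?thesis by (simp add: sub_index_def)
  next
    case False
    have "lookup (\<gamma> - unit_index v) w \<le> lookup \<alpha> w" for w
      using l by (cases "w = v")
        (auto simp: sub_index_def lookup_add lookup_minus lookup_single dest: spec[of _ w])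
    then show ?thesis using False by (simp add: sub_index_def)
  qed
next
  assume r: ?r
  show ?l unfolding sub_index_def
  proof
    fix w
    show "lookup \<gamma> w \<le> lookup (\<alpha> + unit_index v) w"
      using r unfolding sub_index_def lookup_add lookup_minus
      by (cases "w = v") (auto simp: lookup_single le_diff_conv dest: spec[of _ w])
  qed
qed

lemma finite_sub_index [simp]: "finite {\<gamma>. sub_index \<gamma> (\<alpha> :: 'v::finite mindex)}"
proof (induction \<alpha> rule: mindex_induct)
  case zero
  have "{\<gamma>. sub_index \<gamma> (0 :: 'v mindex)} = {0}"
    by (auto simp: sub_index_def intro: poly_mapping_eqI)
  then show ?case by simp
next
  case (step \<alpha> v)
  have "{\<gamma>. sub_index \<gamma> (\<alpha> + unit_index v)} \<subseteq>
      {\<gamma>. sub_index \<gamma> \<alpha>} \<union> (\<lambda>\<gamma>. \<gamma> + unit_index v) ` {\<gamma>. sub_index \<gamma> \<alpha>}"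
  proof
    fix \<gamma> assume "\<gamma> \<in> {\<gamma>. sub_index \<gamma> (\<alpha> + unit_index v)}"
    then consider "sub_index \<gamma> \<alpha>"
      | "lookup \<gamma> v \<noteq> 0" "sub_index (\<gamma> - unit_index v) \<alpha>"
      unfolding sub_index_add_unit by blast
    then show "\<gamma> \<in> {\<gamma>. sub_index \<gamma> \<alpha>} \<union> (\<lambda>\<gamma>. \<gamma> + unit_index v) ` {\<gamma>. sub_index \<gamma> \<alpha>}"
    proof cases
      case 2
      then show ?thesis
        using unit_index_diff_add[OF 2(1)] by (metis UnI2 imageI mem_Collect_eq)
    qed simp
  qed
  then show ?case
    by (rule finite_subset) (use step in simp)
qed

lemma mbinom_eq_prod_UNIV:
  assumes "sub_index \<gamma> (\<alpha> :: 'v::finite mindex)"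
  shows "mbinom \<alpha> \<gamma> = (\<Prod>v\<in>UNIV. lookup \<alpha> v choose lookup \<gamma> v)"
  unfolding mbinom_def
proof (rule prod.mono_neutral_left)
  show "\<forall>v\<in>UNIV - keys \<alpha>. (lookup \<alpha> v choose lookup \<gamma> v) = 1"
    using assms by (metis DiffD2 binomial_n_0 in_keys_iff le_zero_eq sub_index_def)
qed auto

lemma prod_choose_eq_0:
  assumes "\<not> sub_index \<gamma> (\<alpha> :: 'v::finite mindex)"
  shows "(\<Prod>v\<in>UNIV. lookup \<alpha> v choose lookup \<gamma> v) = 0"
proof -
  from assms obtain v where "lookup \<alpha> v < lookup \<gamma> v"
    by (auto simp: sub_index_def not_le)
  then have "lookup \<alpha> v choose lookup \<gamma> v = 0" by (rule binomial_eq_0)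
  then show ?thesis by (auto intro: prod_zero)
qed

text \<open>Pascal's rule in the variable \<open>v\<close>.\<close>

lemma prod_choose_add_unit:
  fixes \<alpha> :: "'v::finite mindex"
  defines "C \<equiv> \<lambda>\<alpha> \<gamma> :: 'v mindex. \<Prod>v\<in>UNIV. lookup \<alpha> v choose lookup \<gamma> v"
  shows "C (\<alpha> + unit_index v) \<gamma> =
    C \<alpha> \<gamma> + (if lookup \<gamma> v = 0 then 0 else C \<alpha> (\<gamma> - unit_index v))"
proof -
  have split: "C \<alpha> \<gamma> = (lookup \<alpha> v choose lookup \<gamma> v) *
      (\<Prod>w\<in>UNIV - {v}. lookup \<alpha> w choose lookup \<gamma> w)" for \<alpha> \<gamma>
    unfolding C_def by (rule prod.remove) auto
  have rest: "(\<Prod>w\<in>UNIV - {v}. lookup (\<alpha> + unit_index v) w choose lookup \<gamma> w) =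
      (\<Prod>w\<in>UNIV - {v}. lookup \<alpha> w choose lookup \<gamma> w)"
    "(\<Prod>w\<in>UNIV - {v}. lookup \<alpha> w choose lookup (\<gamma> - unit_index v) w) =
      (\<Prod>w\<in>UNIV - {v}. lookup \<alpha> w choose lookup \<gamma> w)"
    by (auto intro!: prod.cong simp: lookup_add lookup_minus lookup_single)
  show ?thesis
    unfolding split rest
    by (cases "lookup \<gamma> v") (simp_all add: lookup_add lookup_minus algebra_simps)
qed

text \<open>
  Maximising one coordinate after another leads to a sum with a single representation: if
  \<open>\<alpha>\<close> and \<open>\<beta>\<close> have the largest \<open>v\<close>-coordinates in \<open>S\<close> and \<open>T\<close>, then so do the summands of any other
  representation of \<open>\<alpha> + \<beta>\<close>.
\<close>

lemma unique_sum_exists: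
  fixes S T :: "'v::finite mindex set"
  assumes "finite S" "S \<noteq> {}" "finite T" "T \<noteq> {}"
  obtains \<alpha> \<beta> where "\<alpha> \<in> S" "\<beta> \<in> T"
    "\<forall>\<alpha>'\<in>S. \<forall>\<beta>'\<in>T. \<alpha>' + \<beta>' = \<alpha> + \<beta> \<longrightarrow> \<alpha>' = \<alpha> \<and> \<beta>' = \<beta>"
proof -
  have agree: "\<exists>\<alpha>\<in>S. \<exists>\<beta>\<in>T. \<forall>\<alpha>'\<in>S. \<forall>\<beta>'\<in>T. \<alpha>' + \<beta>' = \<alpha> + \<beta> \<longrightarrow>
      (\<forall>v\<in>V. lookup \<alpha>' v = lookup \<alpha> v)"
    if "finite V" and "finite S" "S \<noteq> {}" "finite T" "T \<noteq> {}"
    for V :: "'v set" and S T :: "'v mindex set"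
    using that
  proof (induction V arbitrary: S T rule: finite_induct)
    case empty
    then show ?case by blast
  next
    case (insert v V)
    define m where "m = (\<lambda>S :: 'v mindex set. Max ((\<lambda>\<alpha>. lookup \<alpha> v) ` S))"
    define top where "top = (\<lambda>S :: 'v mindex set. {\<alpha>\<in>S. lookup \<alpha> v = m S})"
    have le: "lookup \<alpha> v \<le> m S" if "finite S" "\<alpha> \<in> S" for \<alpha> and S
      using that by (simp add: m_def)
    have ne: "top S \<noteq> {}" if "finite S" "S \<noteq> {}" for S
    proof -
      have "m S \<in> (\<lambda>\<alpha>. lookup \<alpha> v) ` S"
        unfolding m_def using that by (intro Max_in) auto
      then show ?thesis by (auto simp: top_def)
    qed
    have fin: "finite (top S)" if "finite S" for S
      using that by (simp add: top_def)
    have "\<exists>\<alpha>\<in>top S. \<exists>\<beta>\<in>top T. \<forall>\<alpha>'\<in>top S. \<forall>\<beta>'\<in>top T. \<alpha>' + \<beta>' = \<alpha> + \<beta> \<longrightarrow>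
        (\<forall>v\<in>V. lookup \<alpha>' v = lookup \<alpha> v)"
      by (rule insert.IH) (simp_all add: fin ne insert.prems)
    then obtain \<alpha> \<beta> where ab: "\<alpha> \<in> top S" "\<beta> \<in> top T"
      and un: "\<forall>\<alpha>'\<in>top S. \<forall>\<beta>'\<in>top T. \<alpha>' + \<beta>' = \<alpha> + \<beta> \<longrightarrow>
        (\<forall>v\<in>V. lookup \<alpha>' v = lookup \<alpha> v)"
      by blast
    show ?case
    proof (intro bexI ballI impI)
      show "\<alpha> \<in> S" "\<beta> \<in> T" using ab by (auto simp: top_def)
    next
      fix \<alpha>' \<beta>' w
      assume p: "\<alpha>' \<in> S" "\<beta>' \<in> T" "\<alpha>' + \<beta>' = \<alpha> + \<beta>" "w \<in> insert v V"
      have "lookup \<alpha>' v + lookup \<beta>' v = m S + m T"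
        using arg_cong[OF p(3), of "\<lambda>\<delta>. lookup \<delta> v"] ab by (simp add: lookup_add top_def)
      moreover have "lookup \<alpha>' v \<le> m S" "lookup \<beta>' v \<le> m T"
        using le p insert.prems by auto
      ultimately have "lookup \<alpha>' v = m S" "lookup \<beta>' v = m T" by linarith+
      with p have "\<alpha>' \<in> top S" "\<beta>' \<in> top T" by (auto simp: top_def)
      with un p(3) have "\<forall>v\<in>V. lookup \<alpha>' v = lookup \<alpha> v" by blast
      with p(4) ab \<open>lookup \<alpha>' v = m S\<close>
      show "lookup \<alpha>' w = lookup \<alpha> w" by (auto simp: top_def)
    qed
  qed
  from agree[OF finite assms] obtain \<alpha> \<beta> where ab: "\<alpha> \<in> S" "\<beta> \<in> T"
    and un: "\<forall>\<alpha>'\<in>S. \<forall>\<beta>'\<in>T. \<alpha>' + \<beta>' = \<alpha> + \<beta> \<longrightarrow> (\<forall>v\<in>UNIV. lookup \<alpha>' v = lookup \<alpha> v)"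
    by blast
  have "\<alpha>' = \<alpha> \<and> \<beta>' = \<beta>" if "\<alpha>' \<in> S" "\<beta>' \<in> T" "\<alpha>' + \<beta>' = \<alpha> + \<beta>" for \<alpha>' \<beta>'
  proof -
    have "\<alpha>' = \<alpha>" using un that by (intro poly_mapping_eqI) blast
    with that(3) show ?thesis by simp
  qed
  then show ?thesis using that[OF ab] by blast
qed

section \<open>Polynomials\<close>

lemma poly_mapping_additive_induct [case_names single add]:
  fixes P :: "'a \<Rightarrow>\<^sub>0 'b::comm_monoid_add"
  assumes single: "\<And>\<alpha> a. Q (Poly_Mapping.single \<alpha> a)"
    and add: "\<And>P P'. Q P \<Longrightarrow> Q P' \<Longrightarrow> Q (P + P')"
  shows "Q P"
proof (induction P rule: Poly_Mapping.update_induct)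
  case const
  then show ?case using single[of undefined 0] by simp
next
  case (update P \<alpha> a)
  have "Poly_Mapping.update \<alpha> a P = Poly_Mapping.single \<alpha> a + P"
    using update by (intro poly_mapping_eqI)
      (auto simp: lookup_update lookup_add lookup_single in_keys_iff)
  then show ?case using add[OF single update(3)] by simp
qed

lemma sum_single_keys: "(\<Sum>\<alpha>\<in>keys P. Poly_Mapping.single \<alpha> (lookup P \<alpha>)) = P"
  by (rule poly_mapping_eqI)
    (simp add: lookup_sum lookup_single when_def in_keys_iff)

lemma lookup_fun_op_times: "lookup (fun_op f * P) \<alpha> = f * lookup P \<alpha>"
  by (induction P rule: poly_mapping_additive_induct)
    (auto simp: fun_op_def mult_single lookup_single lookup_add algebra_simps when_def)

lemma fun_op_add: "fun_op (f + g) = fun_op f + fun_op g"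
  by (simp add: fun_op_def single_add)

lemma fun_op_mult: "fun_op (f * g) = fun_op f * fun_op g"
  by (simp add: fun_op_def mult_single)

lemma fun_op_0 [simp]: "fun_op 0 = 0" and fun_op_1 [simp]: "fun_op 1 = 1"
  by (simp_all add: fun_op_def)

lemma lookup_times_der_op:
  "lookup (P * der_op v) \<alpha> = (if lookup \<alpha> v = 0 then 0 else lookup P (\<alpha> - unit_index v))"
proof (induction P rule: poly_mapping_additive_induct)
  case (single \<beta> b)
  have "\<beta> + unit_index v = \<alpha> \<longleftrightarrow> lookup \<alpha> v \<noteq> 0 \<and> \<beta> = \<alpha> - unit_index v"
    by (auto simp del: One_nat_def simp: unit_index_diff_add lookup_add)
  then show ?case
    by (auto simp del: One_nat_def simp: der_op_def mult_single lookup_single when_def)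
qed (auto simp: lookup_add algebra_simps)

section \<open>Powers of a commuting family\<close>

lemma deriv_pow_zero [simp]: "deriv_pow F 0 f = f"
  by (simp add: deriv_pow_def)

lemma funpow_commute:
  assumes "\<And>a. f (g a) = g (f a)"
  shows "(f ^^ m) ((g ^^ n) a) = (g ^^ n) ((f ^^ m) a)"
proof -
  have 1: "f ((g ^^ n) a) = (g ^^ n) (f a)" for a
    by (induction n arbitrary: a) (simp_all add: assms)
  show ?thesis by (induction m arbitrary: a) (simp_all add: 1)
qed

lemma deriv_pow_add_unit:
  fixes F :: "'v::finite \<Rightarrow> 'b \<Rightarrow> 'b"
  assumes comm: "\<And>v w a. F v (F w a) = F w (F v a)"
  shows "deriv_pow F (\<alpha> + unit_index v) f = F v (deriv_pow F \<alpha> f)"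
proof -
  define G where "G = (\<lambda>(\<alpha> :: 'v mindex) w. F w ^^ lookup \<alpha> w)"
  have cf: "comp_fun_commute_on UNIV (G \<alpha>)" for \<alpha>
    by unfold_locales (auto simp: G_def fun_eq_iff intro: funpow_commute comm)
  have all: "deriv_pow F \<alpha> f = Finite_Set.fold (G \<alpha>) f UNIV" for \<alpha>
  proof -
    interpret comp_fun_commute_on UNIV "G \<alpha>" by (rule cf)
    have "Finite_Set.fold (G \<alpha>) f (S \<union> keys \<alpha>) = Finite_Set.fold (G \<alpha>) f (keys \<alpha>)"
      if "finite S" "S \<inter> keys \<alpha> = {}" for S
      using that
    proof (induction S rule: finite_induct)
      case (insert x S)
      have "Finite_Set.fold (G \<alpha>) f (insert x (S \<union> keys \<alpha>)) =
          G \<alpha> x (Finite_Set.fold (G \<alpha>) f (S \<union> keys \<alpha>))"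
        by (rule fold_insert) (use insert in auto)
      with insert show ?case by (simp add: G_def in_keys_iff)
    qed simp
    from this[of "- keys \<alpha>"] show ?thesis
      by (simp add: deriv_pow_def G_def Compl_partition2)
  qed
  have split: "Finite_Set.fold (G \<alpha>) f UNIV =
      (F v ^^ lookup \<alpha> v) (Finite_Set.fold (G \<alpha>) f (UNIV - {v}))" for \<alpha>
  proof -
    interpret comp_fun_commute_on UNIV "G \<alpha>" by (rule cf)
    show ?thesis
      using fold_rec[of UNIV v f] by (simp add: G_def)
  qed
  have "Finite_Set.fold (G (\<alpha> + unit_index v)) f (UNIV - {v}) =
      Finite_Set.fold (G \<alpha>) f (UNIV - {v})"
    by (rule fold_closed_eq[where B = UNIV]) (auto simp: G_def lookup_add lookup_single)
  then show ?thesis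
    unfolding all split by (simp add: lookup_add)
qed

context partial_differential_field
begin

section \<open>The ring of operators\<close>

lemma D_0 [simp]: "D v 0 = 0"
  using D_add[of v 0 0] by simp

lemma D_1 [simp]: "D v 1 = 0"
  using D_mult[of v 1 1] by simp

lemma D_inverse:
  assumes "f \<noteq> 0"
  shows "D v (inverse f) = - D v f / f\<^sup>2"
proof -
  have "D v f * inverse f + f * D v (inverse f) = 0"
    using D_mult[of v f "inverse f"] assms by simp
  then have "f * D v (inverse f) = - D v f / f"
    by (simp add: field_simps eq_neg_iff_add_eq_0)
  then show ?thesis
    using assms by (simp add: field_simps power2_eq_square)
qed

lemma D_of_nat_mult: "D v (of_nat n * a) = of_nat n * D v a"
  by (induction n) (simp_all add: D_add algebra_simps)

definition coeff_deriv :: "'v \<Rightarrow> ('v, 'k) pdo \<Rightarrow> ('v, 'k) pdo" where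
  "coeff_deriv v Q = Poly_Mapping.map (D v) Q"

lemma lookup_coeff_deriv: "lookup (coeff_deriv v Q) \<alpha> = D v (lookup Q \<alpha>)"
  by (simp add: coeff_deriv_def Poly_Mapping.map.rep_eq when_def)

lemma coeff_deriv_add: "coeff_deriv v (P + Q) = coeff_deriv v P + coeff_deriv v Q"
  by (rule poly_mapping_eqI) (simp add: lookup_coeff_deriv lookup_add D_add)

lemma coeff_deriv_single: "coeff_deriv v (Poly_Mapping.single \<alpha> a) = Poly_Mapping.single \<alpha> (D v a)"
  by (rule poly_mapping_eqI) (simp add: lookup_coeff_deriv lookup_single when_def)

lemma coeff_deriv_fun_op: "coeff_deriv v (fun_op f) = fun_op (D v f)"
  by (simp add: fun_op_def coeff_deriv_single)

lemma coeff_deriv_der_op [simp]: "coeff_deriv v (der_op w) = 0"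
  by (simp add: der_op_def coeff_deriv_single)

lemma coeff_deriv_1 [simp]: "coeff_deriv v 1 = 0"
  using coeff_deriv_fun_op[of v 1] by simp

lemma coeff_deriv_0 [simp]: "coeff_deriv v 0 = 0"
  using coeff_deriv_fun_op[of v 0] by simp

lemma coeff_deriv_times: "coeff_deriv v (P * Q) = coeff_deriv v P * Q + P * coeff_deriv v Q"
proof (induction P rule: poly_mapping_additive_induct)
  case (single \<alpha> a)
  show ?case
    by (induction Q rule: poly_mapping_additive_induct)
      (simp_all add: mult_single coeff_deriv_single coeff_deriv_add D_mult single_add algebra_simps)
qed (simp add: coeff_deriv_add algebra_simps)

lemma coeff_deriv_commute: "coeff_deriv v (coeff_deriv w Q) = coeff_deriv w (coeff_deriv v Q)"
  by (rule poly_mapping_eqI) (simp add: lookup_coeff_deriv D_commute)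

text \<open>
  The rule \<open>\<partial>\<^sub>v q = q \<partial>\<^sub>v + \<partial>\<^sub>v[q]\<close> turns left multiplication by \<open>\<partial>\<^sub>v\<close> into a map on the commutative
  polynomial ring: multiplication by the variable plus differentiation of the coefficients. The two
  summands commute, and so do the maps for different variables.
\<close>

definition left_der :: "'v \<Rightarrow> ('v, 'k) pdo \<Rightarrow> ('v, 'k) pdo" where
  "left_der v Q = der_op v * Q + coeff_deriv v Q"

lemma left_der_eq: "left_der v Q = Q * der_op v + coeff_deriv v Q"
  by (simp add: left_der_def mult.commute)

lemma left_der_commute: "left_der v (left_der w Q) = left_der w (left_der v Q)"
  by (simp add: left_der_def coeff_deriv_add coeff_deriv_times coeff_deriv_commute[of v w] algebra_simps)

lemma left_der_add: "left_der v (P + Q) = left_der v P + left_der v Q"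
  by (simp add: left_der_def coeff_deriv_add algebra_simps)

lemma left_der_0 [simp]: "left_der v 0 = 0"
  by (simp add: left_der_def)

lemma left_der_sum: "left_der v (sum F S) = (\<Sum>x\<in>S. left_der v (F x))"
  by (induction S rule: infinite_finite_induct) (simp_all add: left_der_add)

lemma left_der_single:
  "left_der v (Poly_Mapping.single \<alpha> a) =
     Poly_Mapping.single (\<alpha> + unit_index v) a + Poly_Mapping.single \<alpha> (D v a)"
  by (simp add: left_der_def coeff_deriv_single der_op_def mult_single add.commute)

lemma left_der_fun_op_times: "left_der v (fun_op f * Q) = fun_op f * left_der v Q + fun_op (D v f) * Q"
  by (simp add: left_der_def coeff_deriv_times coeff_deriv_fun_op algebra_simps)

abbreviation left_pow :: "'v mindex \<Rightarrow> ('v, 'k) pdo \<Rightarrow> ('v, 'k) pdo" where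
  "left_pow \<equiv> deriv_pow left_der"

lemma left_pow_add_unit: "left_pow (\<alpha> + unit_index v) Q = left_der v (left_pow \<alpha> Q)"
  by (rule deriv_pow_add_unit) (rule left_der_commute)

lemma left_pow_add: "left_pow \<alpha> (P + Q) = left_pow \<alpha> P + left_pow \<alpha> Q"
  by (induction \<alpha> rule: mindex_induct) (simp_all del: One_nat_def add: left_pow_add_unit left_der_add)

lemma left_pow_0 [simp]: "left_pow \<alpha> 0 = 0"
  by (induction \<alpha> rule: mindex_induct) (simp_all del: One_nat_def add: left_pow_add_unit)

lemma left_pow_sum: "left_pow \<alpha> (sum F S) = (\<Sum>x\<in>S. left_pow \<alpha> (F x))"
  by (induction S rule: infinite_finite_induct) (simp_all add: left_pow_add)

text \<open>
  The Leibniz rule, by induction on \<open>\<alpha>\<close>: multiplying by one more \<open>\<partial>\<^sub>v\<close> either differentiates the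
  coefficient, which raises \<open>\<gamma>\<close>, or leaves it, and the binomials add up by Pascal's rule.
\<close>

lemma left_pow_single:
  "left_pow \<alpha> (Poly_Mapping.single \<beta> b) =
     (\<Sum>\<gamma> | sub_index \<gamma> \<alpha>. Poly_Mapping.single (\<alpha> - \<gamma> + \<beta>) (of_nat (mbinom \<alpha> \<gamma>) * deriv_pow D \<gamma> b))"
proof -
  define C where "C = (\<lambda>\<alpha> \<gamma> :: 'v mindex. \<Prod>v\<in>UNIV. lookup \<alpha> v choose lookup \<gamma> v)"
  define X where "X = (\<lambda>\<delta> \<gamma> n. Poly_Mapping.single (\<delta> - \<gamma> + \<beta>) (of_nat n * deriv_pow D \<gamma> b))"
  have C_0: "C \<alpha> \<gamma> = 0" if "\<not> sub_index \<gamma> \<alpha>" for \<alpha> \<gamma>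
    unfolding C_def using that by (rule prod_choose_eq_0)
  have X_0: "X \<delta> \<gamma> 0 = 0" for \<delta> \<gamma>
    by (simp add: X_def)
  have X_add: "X \<delta> \<gamma> (m + n) = X \<delta> \<gamma> m + X \<delta> \<gamma> n" for \<delta> \<gamma> m n
    by (simp add: X_def single_add algebra_simps)
  have "left_pow \<alpha> (Poly_Mapping.single \<beta> b) = (\<Sum>\<gamma> | sub_index \<gamma> \<alpha>. X \<alpha> \<gamma> (C \<alpha> \<gamma>))"
  proof (induction \<alpha> rule: mindex_induct)
    case zero
    have "{\<gamma>. sub_index \<gamma> (0 :: 'v mindex)} = {0}"
      by (auto simp: sub_index_def intro: poly_mapping_eqI)
    then show ?case by (simp add: X_def C_def)
  next
    case (step \<alpha> v)
    let ?e = "unit_index v"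
    let ?S = "{\<gamma>. sub_index \<gamma> (\<alpha> + ?e)}"
    have "left_der v (X \<alpha> \<gamma> n) = X (\<alpha> + ?e) \<gamma> n + X (\<alpha> + ?e) (\<gamma> + ?e) n"
      if "sub_index \<gamma> \<alpha>" for \<gamma> n
    proof -
      have "\<alpha> - \<gamma> + \<beta> + ?e = \<alpha> + ?e - \<gamma> + \<beta>"
      proof (rule poly_mapping_eqI)
        fix w
        have "lookup \<gamma> w \<le> lookup \<alpha> w" using that by (simp add: sub_index_def)
        then show "lookup (\<alpha> - \<gamma> + \<beta> + ?e) w = lookup (\<alpha> + ?e - \<gamma> + \<beta>) w"
          by (simp add: lookup_add lookup_minus)
      qed
      moreover have "D v (deriv_pow D \<gamma> b) = deriv_pow D (\<gamma> + ?e) b"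
        by (rule deriv_pow_add_unit[symmetric]) (rule D_commute)
      ultimately show ?thesis
        by (simp add: X_def left_der_single D_of_nat_mult)
    qed
    then have "left_pow (\<alpha> + ?e) (Poly_Mapping.single \<beta> b) =
        (\<Sum>\<gamma> | sub_index \<gamma> \<alpha>. X (\<alpha> + ?e) \<gamma> (C \<alpha> \<gamma>)) +
        (\<Sum>\<gamma> | sub_index \<gamma> \<alpha>. X (\<alpha> + ?e) (\<gamma> + ?e) (C \<alpha> \<gamma>))"
      unfolding left_pow_add_unit step.IH left_der_sum sum.distrib[symmetric]
      by (intro sum.cong) auto
    also have "(\<Sum>\<gamma> | sub_index \<gamma> \<alpha>. X (\<alpha> + ?e) \<gamma> (C \<alpha> \<gamma>)) = (\<Sum>\<gamma>\<in>?S. X (\<alpha> + ?e) \<gamma> (C \<alpha> \<gamma>))"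
    proof (rule sum.mono_neutral_left)
      show "\<forall>\<gamma>\<in>?S - {\<gamma>. sub_index \<gamma> \<alpha>}. X (\<alpha> + ?e) \<gamma> (C \<alpha> \<gamma>) = 0"
        by (auto simp del: One_nat_def simp: C_0 X_0)
      show "{\<gamma>. sub_index \<gamma> \<alpha>} \<subseteq> ?S"
        unfolding sub_index_add_unit by blast
    qed (rule finite_sub_index)
    also have "(\<Sum>\<gamma> | sub_index \<gamma> \<alpha>. X (\<alpha> + ?e) (\<gamma> + ?e) (C \<alpha> \<gamma>)) =
        (\<Sum>\<gamma> | lookup \<gamma> v \<noteq> 0 \<and> sub_index (\<gamma> - ?e) \<alpha>. X (\<alpha> + ?e) \<gamma> (C \<alpha> (\<gamma> - ?e)))"
      by (rule sum.reindex_bij_witness[where i = "\<lambda>\<gamma>. \<gamma> - ?e" and j = "\<lambda>\<gamma>. \<gamma> + ?e"])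
        (auto simp del: One_nat_def simp: unit_index_diff_add lookup_add)
    also have "\<dots> = (\<Sum>\<gamma>\<in>?S. X (\<alpha> + ?e) \<gamma> (if lookup \<gamma> v = 0 then 0 else C \<alpha> (\<gamma> - ?e)))"
    proof (rule sum.mono_neutral_cong_left)
      show "\<forall>\<gamma>\<in>?S - {\<gamma>. lookup \<gamma> v \<noteq> 0 \<and> sub_index (\<gamma> - ?e) \<alpha>}.
          X (\<alpha> + ?e) \<gamma> (if lookup \<gamma> v = 0 then 0 else C \<alpha> (\<gamma> - ?e)) = 0"
      proof
        fix \<gamma> assume "\<gamma> \<in> ?S - {\<gamma>. lookup \<gamma> v \<noteq> 0 \<and> sub_index (\<gamma> - ?e) \<alpha>}"
        then have "lookup \<gamma> v = 0 \<or> C \<alpha> (\<gamma> - ?e) = 0"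
          by (cases "lookup \<gamma> v = 0") (simp_all del: One_nat_def add: C_0)
        then show "X (\<alpha> + ?e) \<gamma> (if lookup \<gamma> v = 0 then 0 else C \<alpha> (\<gamma> - ?e)) = 0"
          using X_0 by presburger
      qed
      show "{\<gamma>. lookup \<gamma> v \<noteq> 0 \<and> sub_index (\<gamma> - ?e) \<alpha>} \<subseteq> ?S"
        unfolding sub_index_add_unit by blast
    qed (rule finite_sub_index, simp)
    also have "(\<Sum>\<gamma>\<in>?S. X (\<alpha> + ?e) \<gamma> (C \<alpha> \<gamma>)) + \<dots> = (\<Sum>\<gamma>\<in>?S. X (\<alpha> + ?e) \<gamma> (C (\<alpha> + ?e) \<gamma>))"
      unfolding C_def prod_choose_add_unit X_add sum.distrib ..
    finally show ?case .
  qed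
  then show ?thesis
    by (simp add: X_def C_def mbinom_eq_prod_UNIV)
qed

abbreviation mult (infixl "\<star>" 70) where
  "P \<star> Q \<equiv> op_mult D P Q"

text \<open>
  This turns the formula that defines the product into iterated left multiplications, from which
  associativity is read off without any binomial identity.
\<close>

lemma op_mult_eq_left_pow: "P \<star> Q = (\<Sum>\<alpha>\<in>keys P. fun_op (lookup P \<alpha>) * left_pow \<alpha> Q)"
proof -
  have "fun_op a * left_pow \<alpha> Q = (\<Sum>\<beta>\<in>keys Q. \<Sum>\<gamma> | sub_index \<gamma> \<alpha>.
      Poly_Mapping.single (\<alpha> - \<gamma> + \<beta>) (of_nat (mbinom \<alpha> \<gamma>) * a * deriv_pow D \<gamma> (lookup Q \<beta>)))" for \<alpha> a
  proof -
    have "left_pow \<alpha> Q = (\<Sum>\<beta>\<in>keys Q. left_pow \<alpha> (Poly_Mapping.single \<beta> (lookup Q \<beta>)))"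
      by (subst sum_single_keys[symmetric]) (rule left_pow_sum)
    then show ?thesis
      by (simp add: left_pow_single sum_distrib_left fun_op_def mult_single mult.left_commute mult.assoc)
  qed
  then show ?thesis
    by (simp add: op_mult_def)
qed

lemma op_mult_add_left: "(P + P') \<star> Q = P \<star> Q + P' \<star> Q"
  unfolding op_mult_eq_left_pow
  by (rule setsum_keys_plus_distrib) (simp_all add: fun_op_add distrib_right)

lemma op_mult_add_right: "P \<star> (Q + Q') = P \<star> Q + P \<star> Q'"
  by (simp add: op_mult_eq_left_pow left_pow_add sum.distrib distrib_left)

lemma op_mult_single: "Poly_Mapping.single \<alpha> a \<star> Q = fun_op a * left_pow \<alpha> Q"
  by (cases "a = 0") (simp_all add: op_mult_eq_left_pow)

lemma op_mult_0_left [simp]: "0 \<star> Q = 0" and op_mult_0_right [simp]: "P \<star> 0 = 0"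
  by (simp_all add: op_mult_eq_left_pow)

lemma op_mult_diff_left: "(P - P') \<star> Q = P \<star> Q - P' \<star> Q"
  using op_mult_add_left[of "P - P'" P' Q] by (simp add: algebra_simps)

lemma op_mult_diff_right: "P \<star> (Q - Q') = P \<star> Q - P \<star> Q'"
  using op_mult_add_right[of P "Q - Q'" Q'] by (simp add: algebra_simps)

lemma op_mult_fun_op: "fun_op f \<star> Q = fun_op f * Q"
  by (subst fun_op_def) (simp add: op_mult_single)

lemma op_mult_der_op: "der_op v \<star> Q = left_der v Q"
  using left_pow_add_unit[of 0 v Q] by (simp add: der_op_def op_mult_single)

lemma left_der_mult: "left_der v P \<star> Q = left_der v (P \<star> Q)"
proof (induction P rule: poly_mapping_additive_induct)
  case (single \<alpha> a)
  show ?case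
    by (simp del: One_nat_def
        add: left_der_single op_mult_add_left op_mult_single left_pow_add_unit left_der_fun_op_times)
qed (simp add: op_mult_add_left left_der_add)

lemma left_pow_mult: "left_pow \<alpha> P \<star> Q = left_pow \<alpha> (P \<star> Q)"
  by (induction \<alpha> rule: mindex_induct) (simp_all del: One_nat_def add: left_pow_add_unit left_der_mult)

lemma fun_op_times_mult: "(fun_op f * P) \<star> Q = fun_op f * (P \<star> Q)"
proof (induction P rule: poly_mapping_additive_induct)
  case (single \<alpha> a)
  have "fun_op f * Poly_Mapping.single \<alpha> a = Poly_Mapping.single \<alpha> (f * a)"
    by (simp add: fun_op_def mult_single)
  then show ?case
    by (simp add: op_mult_single fun_op_mult mult.assoc)
qed (simp add: op_mult_add_left distrib_left)

text \<open>
  Left multiplication by \<open>a \<partial>\<^sup>\<alpha>\<close> is composed of maps that commute with multiplication from the right.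
\<close>

lemma op_mult_assoc: "(P \<star> Q) \<star> R = P \<star> (Q \<star> R)"
  by (induction P rule: poly_mapping_additive_induct)
    (simp_all add: op_mult_add_left op_mult_single fun_op_times_mult left_pow_mult)

text \<open>
  A right factor with constant coefficients is not differentiated, and the product is the
  commutative one.
\<close>

lemma left_pow_times:
  assumes "\<And>v. coeff_deriv v Q = 0"
  shows "left_pow \<alpha> (P * Q) = left_pow \<alpha> P * Q"
proof -
  have "left_der v (P * Q) = left_der v P * Q" for v P
    by (simp add: left_der_def coeff_deriv_times assms algebra_simps)
  then show ?thesis
    by (induction \<alpha> rule: mindex_induct) (simp_all del: One_nat_def add: left_pow_add_unit)
qed

lemma left_pow_1: "left_pow \<alpha> 1 = Poly_Mapping.single \<alpha> 1"
proof (induction \<alpha> rule: mindex_induct)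
  case (step \<alpha> v)
  then show ?case
    by (simp del: One_nat_def add: left_pow_add_unit left_der_single)
qed simp

lemma op_mult_const_right:
  assumes "\<And>v. coeff_deriv v Q = 0"
  shows "P \<star> Q = P * Q"
proof (induction P rule: poly_mapping_additive_induct)
  case (single \<alpha> a)
  have "Poly_Mapping.single \<alpha> a = fun_op a * Poly_Mapping.single \<alpha> 1"
    by (simp add: fun_op_def mult_single)
  with left_pow_times[OF assms, of \<alpha> 1] show ?case
    unfolding op_mult_single by (simp add: left_pow_1 mult.assoc)
qed (simp add: op_mult_add_left distrib_right)

lemma op_mult_1_left [simp]: "1 \<star> P = P" and op_mult_1_right [simp]: "P \<star> 1 = P"
  using op_mult_fun_op[of 1] op_mult_const_right[of 1] by simp_all

lemma op_mult_der_op_right: "P \<star> der_op v = P * der_op v"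
  by (rule op_mult_const_right) simp

end

section \<open>Order and principal symbol\<close>

text \<open>
  The zero operator has degree less than every \<open>n\<close>, also less than \<open>0\<close>. An inequality
  for \<open>op_order\<close> could not say this, since \<open>op_order 0 = 0\<close>.
\<close>

definition deg_less :: "nat \<Rightarrow> ('v, 'k::zero) pdo \<Rightarrow> bool" where
  "deg_less n P \<longleftrightarrow> (\<forall>\<alpha>. n \<le> mdeg \<alpha> \<longrightarrow> lookup P \<alpha> = 0)"

lemma deg_less_0 [simp]: "deg_less n 0"
  by (simp add: deg_less_def)

lemma deg_less_mono: "deg_less m P \<Longrightarrow> m \<le> n \<Longrightarrow> deg_less n P"
  by (auto simp: deg_less_def)

lemma deg_less_add:
  "deg_less n P \<Longrightarrow> deg_less n Q \<Longrightarrow> deg_less n (P + Q :: ('v, 'k::comm_monoid_add) pdo)"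
  by (auto simp: deg_less_def lookup_add)

lemma deg_less_diff:
  "deg_less n P \<Longrightarrow> deg_less n Q \<Longrightarrow> deg_less n (P - Q :: ('v, 'k::ab_group_add) pdo)"
  by (auto simp: deg_less_def lookup_minus)

lemma deg_less_sum:
  "(\<And>x. x \<in> S \<Longrightarrow> deg_less n (F x)) \<Longrightarrow> deg_less n (sum F S :: ('v, 'k::comm_monoid_add) pdo)"
  by (auto simp: deg_less_def lookup_sum)

lemma deg_less_fun_op_times: "deg_less n P \<Longrightarrow> deg_less n (fun_op f * P)"
  by (simp add: deg_less_def lookup_fun_op_times)

lemma deg_less_times_der_op:
  assumes "deg_less n P"
  shows "deg_less (Suc n) (P * der_op (v :: 'v::finite))"
  unfolding deg_less_def lookup_times_der_op
proof (intro allI impI)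
  fix \<alpha> :: "'v mindex" assume n: "Suc n \<le> mdeg \<alpha>"
  have "mdeg \<alpha> = mdeg (\<alpha> - unit_index v) + 1" if "lookup \<alpha> v \<noteq> 0"
    using mdeg_add[of "\<alpha> - unit_index v" "unit_index v"]
    by (simp del: One_nat_def add: unit_index_diff_add[OF that] mdeg_unit_index)
  with n assms show "(if lookup \<alpha> v = 0 then 0 else lookup P (\<alpha> - unit_index v)) = 0"
    by (auto simp: deg_less_def)
qed

lemma mdeg_le_op_order: "\<alpha> \<in> keys P \<Longrightarrow> mdeg \<alpha> \<le> op_order P"
  by (simp add: op_order_def)

lemma deg_less_op_order: "deg_less (Suc (op_order P)) P"
  unfolding deg_less_def by (metis in_keys_iff mdeg_le_op_order not_less_eq_eq)

lemma op_order_attained: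
  assumes "P \<noteq> 0"
  obtains \<alpha> where "\<alpha> \<in> keys P" "mdeg \<alpha> = op_order P"
proof -
  have "keys P \<noteq> {}"
    using assms by (metis empty_iff in_keys_iff lookup_zero poly_mapping_eqI)
  then have "op_order P = Max (mdeg ` keys P)"
    by (simp add: op_order_def)
  also have "\<dots> \<in> mdeg ` keys P"
    using \<open>keys P \<noteq> {}\<close> by (intro Max_in) auto
  finally show ?thesis using that by auto
qed

lemma lookup_symbol: "lookup (symbol P) \<alpha> = (if mdeg \<alpha> = op_order P then lookup P \<alpha> else 0)"
  unfolding symbol_def lookup_sum lookup_single when_def
  by (subst sum.delta) (auto simp: in_keys_iff)

text \<open>
  Only the order of \<open>P\<close> occurs on the right. Agreement of all coefficients from that degree on
  already forces \<open>Q\<close> to have the same order, and it forces \<open>Q = 0\<close> if \<open>P = 0\<close>.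
\<close>

lemma symbol_eq_iff: "symbol P = symbol Q \<longleftrightarrow> deg_less (op_order P) (P - Q)"
proof
  assume eq: "symbol P = symbol Q"
  have sym: "(if mdeg \<alpha> = op_order P then lookup P \<alpha> else 0) =
      (if mdeg \<alpha> = op_order Q then lookup Q \<alpha> else 0)" for \<alpha>
    using eq lookup_symbol by metis
  have order: "P = 0 \<and> Q = 0 \<or> op_order P = op_order Q"
  proof (cases "P = 0")
    case True
    have "Q = 0"
    proof (rule ccontr)
      assume "Q \<noteq> 0"
      then obtain \<beta> where "\<beta> \<in> keys Q" "mdeg \<beta> = op_order Q"
        by (rule op_order_attained)
      with True sym[of \<beta>] show False by (simp add: in_keys_iff split: if_splits)
    qed
    with True show ?thesis by simp
  next
    case False
    then obtain \<alpha> where "\<alpha> \<in> keys P" "mdeg \<alpha> = op_order P"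
      by (rule op_order_attained)
    with sym[of \<alpha>] show ?thesis by (auto simp: in_keys_iff split: if_splits)
  qed
  show "deg_less (op_order P) (P - Q)"
    unfolding deg_less_def
  proof (intro allI impI)
    fix \<alpha> :: "'a mindex" assume "op_order P \<le> mdeg \<alpha>"
    then consider "mdeg \<alpha> = op_order P" | "Suc (op_order P) \<le> mdeg \<alpha>" by linarith
    then show "lookup (P - Q) \<alpha> = 0"
      using order sym[of \<alpha>] deg_less_op_order[of P] deg_less_op_order[of Q]
      by cases (auto simp: lookup_minus deg_less_def)
  qed
next
  assume "deg_less (op_order P) (P - Q)"
  then have eq: "lookup P \<alpha> = lookup Q \<alpha>" if "op_order P \<le> mdeg \<alpha>" for \<alpha>
    using that by (auto simp: deg_less_def lookup_minus)
  show "symbol P = symbol Q"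
  proof (cases "P = 0")
    case True
    then have "P = Q"
      using eq by (intro poly_mapping_eqI) (simp add: op_order_def)
    then show ?thesis by simp
  next
    case False
    then obtain \<alpha> where \<alpha>: "\<alpha> \<in> keys P" "mdeg \<alpha> = op_order P"
      by (rule op_order_attained)
    then have "op_order P \<le> op_order Q"
      using eq mdeg_le_op_order[of \<alpha> Q] by (simp add: in_keys_iff)
    moreover have "op_order Q \<le> op_order P"
    proof (rule ccontr)
      assume less: "\<not> op_order Q \<le> op_order P"
      then have "Q \<noteq> 0" by (auto simp: op_order_def)
      then obtain \<beta> where "\<beta> \<in> keys Q" "mdeg \<beta> = op_order Q"
        by (rule op_order_attained)
      with less eq[of \<beta>] mdeg_le_op_order[of \<beta> P] show False
        by (simp add: in_keys_iff)
    qed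
    ultimately have "op_order P = op_order Q" by simp
    with eq show ?thesis
      by (intro poly_mapping_eqI) (auto simp: lookup_symbol)
  qed
qed

text \<open>
  The variables carry no order, so a leading monomial is not at hand. A sum \<open>\<alpha> + \<beta>\<close> of top-degree
  indices that arises in a single way serves the same purpose: its coefficient in the product is
  just the product of two nonzero coefficients. Degrees rule out representations by indices that are
  not of top degree.
\<close>

lemma times_top_coefficient:
  fixes P Q :: "('v::finite, 'k::{comm_ring_1, semiring_no_zero_divisors}) pdo"
  assumes "P \<noteq> 0" "Q \<noteq> 0"
  obtains \<delta> where "mdeg \<delta> = op_order P + op_order Q" "lookup (P * Q) \<delta> \<noteq> 0"
proof -
  define top where "top = (\<lambda>P :: ('v, 'k) pdo. {\<alpha>\<in>keys P. mdeg \<alpha> = op_order P})"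
  have top: "finite (top P)" "top P \<noteq> {}" if ne: "P \<noteq> 0" for P
  proof -
    obtain \<alpha> where "\<alpha> \<in> keys P" "mdeg \<alpha> = op_order P"
      using ne by (rule op_order_attained)
    then show "top P \<noteq> {}" by (auto simp: top_def)
  qed (simp add: top_def)
  obtain \<alpha> \<beta> where ab: "\<alpha> \<in> top P" "\<beta> \<in> top Q"
    and un: "\<forall>\<alpha>'\<in>top P. \<forall>\<beta>'\<in>top Q. \<alpha>' + \<beta>' = \<alpha> + \<beta> \<longrightarrow> \<alpha>' = \<alpha> \<and> \<beta>' = \<beta>"
    by (rule unique_sum_exists[OF top[OF assms(1)] top[OF assms(2)]])
  have deg: "mdeg (\<alpha> + \<beta>) = op_order P + op_order Q"
    using ab by (simp add: mdeg_add top_def)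
  have un': "\<alpha>' = \<alpha> \<and> \<beta>' = \<beta>" if "\<alpha>' \<in> keys P" "\<beta>' \<in> keys Q" "\<alpha>' + \<beta>' = \<alpha> + \<beta>" for \<alpha>' \<beta>'
  proof -
    have "mdeg \<alpha>' + mdeg \<beta>' = op_order P + op_order Q"
      using deg that(3) by (metis mdeg_add)
    with mdeg_le_op_order[OF that(1)] mdeg_le_op_order[OF that(2)]
    have "\<alpha>' \<in> top P" "\<beta>' \<in> top Q" using that by (auto simp: top_def)
    with un that(3) show ?thesis by blast
  qed
  have "P * Q = (\<Sum>\<alpha>'\<in>keys P. \<Sum>\<beta>'\<in>keys Q.
      Poly_Mapping.single (\<alpha>' + \<beta>') (lookup P \<alpha>' * lookup Q \<beta>'))"
    by (subst (1) sum_single_keys[of P, symmetric], subst (1) sum_single_keys[of Q, symmetric])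
      (simp add: sum_product mult_single)
  then have "lookup (P * Q) (\<alpha> + \<beta>) = (\<Sum>\<alpha>'\<in>keys P. \<Sum>\<beta>'\<in>keys Q.
      if \<alpha>' + \<beta>' = \<alpha> + \<beta> then lookup P \<alpha>' * lookup Q \<beta>' else 0)"
    by (simp add: lookup_sum lookup_single when_def)
  also have "\<dots> = (\<Sum>\<alpha>'\<in>keys P. \<Sum>\<beta>'\<in>keys Q.
      if \<beta>' = \<beta> then if \<alpha>' = \<alpha> then lookup P \<alpha> * lookup Q \<beta> else 0 else 0)"
    using un' by (intro sum.cong refl) auto
  also have "\<dots> = lookup P \<alpha> * lookup Q \<beta>"
    using ab by (simp add: top_def)
  finally have "lookup (P * Q) (\<alpha> + \<beta>) \<noteq> 0"
    using ab by (simp add: top_def in_keys_iff)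
  with deg show ?thesis by (rule that)
qed

context partial_differential_field
begin

lemma deg_less_coeff_deriv: "deg_less n P \<Longrightarrow> deg_less n (coeff_deriv v P)"
  by (simp add: deg_less_def lookup_coeff_deriv)

text \<open>
  The second part bounds the degree of \<open>\<partial>\<^sup>\<alpha> Q\<close> itself, which the induction needs for the term in
  which the next derivation falls on the coefficients.
\<close>

lemma left_pow_approx:
  assumes "deg_less (Suc n) Q"
  shows "deg_less (n + mdeg \<alpha>) (left_pow \<alpha> Q - Poly_Mapping.single \<alpha> 1 * Q)
    \<and> deg_less (Suc n + mdeg \<alpha>) (left_pow \<alpha> Q)"
proof (induction \<alpha> rule: mindex_induct)
  case zero
  have "mdeg (0 :: 'v mindex) = 0" by (simp add: mdeg_def)
  with assms show ?case by simp
next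
  case (step \<alpha> v)
  let ?P = "left_pow \<alpha> Q" and ?S = "Poly_Mapping.single \<alpha> 1 * Q"
  have deg: "mdeg (\<alpha> + unit_index v) = Suc (mdeg \<alpha>)"
    by (simp del: One_nat_def add: mdeg_add mdeg_unit_index)
  have "Poly_Mapping.single (\<alpha> + unit_index v) 1 * Q = der_op v * ?S"
    by (simp add: der_op_def mult_single mult.assoc[symmetric] add.commute)
  then have "left_der v ?P - Poly_Mapping.single (\<alpha> + unit_index v) 1 * Q =
      (?P - ?S) * der_op v + coeff_deriv v ?P"
    by (simp add: left_der_def algebra_simps)
  moreover have "deg_less (Suc (n + mdeg \<alpha>)) ((?P - ?S) * der_op v + coeff_deriv v ?P)"
    using step by (intro deg_less_add deg_less_times_der_op deg_less_coeff_deriv) auto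
  moreover have "deg_less (Suc (Suc (n + mdeg \<alpha>))) (left_der v ?P)"
    unfolding left_der_eq[of v ?P]
  proof (intro deg_less_add deg_less_times_der_op deg_less_coeff_deriv)
    show "deg_less (Suc (n + mdeg \<alpha>)) ?P" using step by simp
    then show "deg_less (Suc (Suc (n + mdeg \<alpha>))) ?P" by (rule deg_less_mono) simp
  qed
  ultimately show ?case
    by (simp del: One_nat_def add: left_pow_add_unit deg)
qed

text \<open>In the top degree, coefficients are not differentiated.\<close>

lemma op_mult_approx:
  assumes P: "deg_less (Suc m) P" and Q: "deg_less (Suc n) Q"
  shows "deg_less (m + n) (P \<star> Q - P * Q)"
proof -
  have "P * Q = (\<Sum>\<alpha>\<in>keys P. fun_op (lookup P \<alpha>) * (Poly_Mapping.single \<alpha> 1 * Q))"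
    by (subst (1) sum_single_keys[of P, symmetric])
      (simp add: sum_distrib_right fun_op_def mult_single mult.assoc[symmetric])
  then have "P \<star> Q - P * Q = (\<Sum>\<alpha>\<in>keys P.
      fun_op (lookup P \<alpha>) * (left_pow \<alpha> Q - Poly_Mapping.single \<alpha> 1 * Q))"
    by (simp add: op_mult_eq_left_pow sum_subtractf right_diff_distrib)
  moreover have "deg_less (m + n) (fun_op (lookup P \<alpha>) * (left_pow \<alpha> Q - Poly_Mapping.single \<alpha> 1 * Q))"
    if "\<alpha> \<in> keys P" for \<alpha>
  proof -
    have "mdeg \<alpha> \<le> m"
      using P that by (metis deg_less_def in_keys_iff not_less_eq_eq)
    then show ?thesis
      using left_pow_approx[OF Q, of \<alpha>] by (intro deg_less_fun_op_times) (auto intro: deg_less_mono)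
  qed
  ultimately show ?thesis by (simp add: deg_less_sum)
qed

text \<open>
  In the sum of the two orders, the coefficients of the operator product are those of the commutative
  product, so a nonzero one survives. Hence there are no zero divisors, and orders add up.
\<close>

lemma op_mult_top_coefficient:
  assumes "P \<noteq> 0" "Q \<noteq> 0"
  obtains \<delta> where "mdeg \<delta> = op_order P + op_order Q" "lookup (P \<star> Q) \<delta> \<noteq> 0"
proof -
  obtain \<delta> where \<delta>: "mdeg \<delta> = op_order P + op_order Q" "lookup (P * Q) \<delta> \<noteq> 0"
    using times_top_coefficient[OF assms] .
  have "lookup (P \<star> Q) \<delta> = lookup (P * Q) \<delta>"
    using op_mult_approx[OF deg_less_op_order[of P] deg_less_op_order[of Q]] \<delta>(1)
    by (simp add: deg_less_def lookup_minus)
  with \<delta>(2) have "lookup (P \<star> Q) \<delta> \<noteq> 0" by simp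
  with \<delta>(1) show ?thesis by (rule that)
qed

section \<open>Conjugation\<close>

lemma fun_op_inverse_mult: "f \<noteq> 0 \<Longrightarrow> fun_op f \<star> fun_op (inverse f) = 1"
  and fun_op_inverse_mult': "f \<noteq> 0 \<Longrightarrow> fun_op (inverse f) \<star> fun_op f = 1"
  by (simp_all add: op_mult_fun_op flip: fun_op_mult)

lemma op_conj_eq: "op_conj D g P = fun_op (inverse g) * (P \<star> fun_op g)"
  by (simp only: op_conj_def op_mult_assoc) (rule op_mult_fun_op)

lemma op_conj_mult:
  assumes "g \<noteq> 0"
  shows "op_conj D g (P \<star> Q) = op_conj D g P \<star> op_conj D g Q"
proof -
  have "P \<star> (fun_op g \<star> (fun_op (inverse g) \<star> R)) = P \<star> R" for R
    by (simp add: op_mult_assoc[symmetric, of "fun_op g"] fun_op_inverse_mult[OF assms])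
  then show ?thesis
    by (simp add: op_conj_def op_mult_assoc)
qed

lemma op_conj_inverse:
  assumes "g \<noteq> 0"
  shows "op_conj D g (op_conj D (inverse g) P) = P"
proof -
  have "op_conj D g (op_conj D (inverse g) P) =
      (fun_op (inverse g) \<star> fun_op g) \<star> P \<star> (fun_op (inverse g) \<star> fun_op g)"
    by (simp add: op_conj_def op_mult_assoc)
  then show ?thesis by (simp add: fun_op_inverse_mult'[OF assms])
qed

lemma op_conj_inj:
  assumes "g \<noteq> 0"
  shows "op_conj D g P = op_conj D g Q \<longleftrightarrow> P = Q"
proof
  assume "op_conj D g P = op_conj D g Q"
  then have "op_conj D (inverse g) (op_conj D g P) = op_conj D (inverse g) (op_conj D g Q)"
    by simp
  with assms show "P = Q"
    using op_conj_inverse[of "inverse g"] by simp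
qed simp

text \<open>
  In top degree \<open>g\<close> is not differentiated, so there it cancels against \<open>g\<^sup>-\<^sup>1\<close>.
\<close>

lemma symbol_op_conj:
  assumes "g \<noteq> 0"
  shows "symbol (op_conj D g P) = symbol P"
proof -
  have "deg_less (op_order P + 0) (P \<star> fun_op g - P * fun_op g)"
    by (intro op_mult_approx deg_less_op_order)
      (auto simp: deg_less_def fun_op_def lookup_single when_def mdeg_def)
  then have "deg_less (op_order P) (fun_op (inverse g) * (P * fun_op g - P \<star> fun_op g))"
    by (intro deg_less_fun_op_times) (simp add: deg_less_def lookup_minus)
  also have "fun_op (inverse g) * (P * fun_op g - P \<star> fun_op g) = P - op_conj D g P"
  proof -
    have "fun_op (inverse g) * (P * fun_op g) = P * fun_op (inverse g * g)"
      by (simp add: fun_op_mult ac_simps)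
    then show ?thesis
      using assms by (simp add: op_conj_eq right_diff_distrib)
  qed
  finally show ?thesis
    by (simp flip: symbol_eq_iff)
qed

lemma op_conj_der_op:
  assumes "g \<noteq> 0"
  shows "op_conj D g (der_op v) = der_op v + fun_op (D v g / g)"
proof -
  have "op_conj D g (der_op v) = der_op v * fun_op (inverse g * g) + fun_op (inverse g * D v g)"
    by (simp add: op_conj_eq op_mult_der_op left_der_def coeff_deriv_fun_op distrib_left fun_op_mult
        ac_simps)
  with assms show ?thesis
    by (simp add: field_simps)
qed

text \<open>
  The operator \<open>\<partial>\<^sub>t\<^sup>1\<^sup>/\<^sup>c\<close> is the monic first-order operator that annihilates \<open>c\<close>.
\<close>

lemma op_conj_reciprocal_der_op:
  assumes "c \<noteq> 0"
  shows "op_conj D (1 / c) (der_op v) = der_op v + fun_op (- D v c / c)"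
  using assms op_conj_der_op[of "1 / c" v] D_inverse[of c v]
  by (simp add: inverse_eq_divide power2_eq_square)

lemma op_conj_fun_op: "g \<noteq> 0 \<Longrightarrow> op_conj D g (fun_op f) = fun_op f"
  by (simp add: op_conj_eq op_mult_fun_op mult.left_commute[of "inverse g"] flip: fun_op_mult)

lemma op_conj_diff: "op_conj D g (P - Q) = op_conj D g P - op_conj D g Q"
  by (simp add: op_conj_def op_mult_diff_left op_mult_diff_right)

end

section \<open>Right division by a derivation\<close>

lemma right_division_by_der_op:
  fixes P :: "('v::finite, 'k::comm_ring_1) pdo"
  obtains A R where "P = A * der_op t + R" "\<forall>\<alpha>\<in>keys R. lookup \<alpha> t = 0"
proof -
  have "\<exists>A R. P = A * der_op t + R \<and> (\<forall>\<alpha>\<in>keys R. lookup \<alpha> t = 0)"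
  proof (induction P rule: poly_mapping_additive_induct)
    case (single \<alpha> a)
    show ?case
    proof (cases "lookup \<alpha> t = 0")
      case True
      then show ?thesis
        by (intro exI[of _ 0] exI[of _ "Poly_Mapping.single \<alpha> a"]) simp
    next
      case False
      then show ?thesis
        by (intro exI[of _ "Poly_Mapping.single (\<alpha> - unit_index t) a"] exI[of _ 0])
          (simp del: One_nat_def add: der_op_def mult_single unit_index_diff_add)
    qed
  next
    case (add P P')
    then obtain A R A' R' where "P = A * der_op t + R" "P' = A' * der_op t + R'"
      and R: "\<forall>\<alpha>\<in>keys R. lookup \<alpha> t = 0" "\<forall>\<alpha>\<in>keys R'. lookup \<alpha> t = 0"
      by blast
    then have "P + P' = (A + A') * der_op t + (R + R')"
      by (simp add: algebra_simps)
    moreover have "\<forall>\<alpha>\<in>keys (R + R'). lookup \<alpha> t = 0"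
      using R keys_add[of R R'] by blast
    ultimately show ?case by blast
  qed
  with that show ?thesis by blast
qed

text \<open>
  The remainder does not contain \<open>\<partial>\<^sub>t\<close>, so the quotient can be read off from the coefficients of the
  dividend.
\<close>

lemma lookup_quotient:
  fixes A R :: "('v::finite, 'k::comm_ring_1) pdo"
  assumes "\<forall>\<alpha>\<in>keys R. lookup \<alpha> t = 0"
  shows "lookup (A * der_op t + R) (\<alpha> + unit_index t) = lookup A \<alpha>"
proof -
  have "lookup R (\<alpha> + unit_index t) = 0"
  proof (rule ccontr)
    assume "lookup R (\<alpha> + unit_index t) \<noteq> 0"
    then have "\<alpha> + unit_index t \<in> keys R" by (simp only: in_keys_iff not_False_eq_True)
    with assms have "lookup (\<alpha> + unit_index t) t = 0" by (rule bspec)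
    then show False by (simp add: lookup_add)
  qed
  then show ?thesis
    by (simp del: One_nat_def add: lookup_add lookup_times_der_op)
qed

lemma right_division_unique:
  fixes A R :: "('v::finite, 'k::comm_ring_1) pdo"
  assumes eq: "A * der_op t + R = A' * der_op t + R'"
    and R: "\<forall>\<alpha>\<in>keys R. lookup \<alpha> t = 0" "\<forall>\<alpha>\<in>keys R'. lookup \<alpha> t = 0"
  shows "A = A' \<and> R = R'"
proof -
  have "A = A'"
    using lookup_quotient[OF R(1)] lookup_quotient[OF R(2)] eq by (intro poly_mapping_eqI) metis
  with eq show ?thesis by simp
qed

lemma deg_less_quotient:
  fixes A R :: "('v::finite, 'k::comm_ring_1) pdo"
  assumes P: "P = A * der_op t + R" and R: "\<forall>\<alpha>\<in>keys R. lookup \<alpha> t = 0"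
  shows "deg_less (op_order P) A"
  unfolding deg_less_def
proof (intro allI impI)
  fix \<alpha> :: "'v mindex" assume "op_order P \<le> mdeg \<alpha>"
  then have "Suc (op_order P) \<le> mdeg (\<alpha> + unit_index t)"
    by (simp only: mdeg_add mdeg_unit_index)
  then have "lookup P (\<alpha> + unit_index t) = 0"
    using deg_less_op_order[of P] by (simp only: deg_less_def)
  then show "lookup A \<alpha> = 0"
    unfolding P lookup_quotient[OF R] .
qed

context partial_differential_field
begin

section \<open>Intertwining with a derivation\<close>

lemma first_order_mult:
  "(der_op t + fun_op f) \<star> (A * der_op t + R) =
     ((der_op t + fun_op f) \<star> A + R) * der_op t + (coeff_deriv t R + fun_op f * R)"
  by (simp add: op_mult_add_left op_mult_der_op op_mult_fun_op left_der_eq coeff_deriv_add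
      coeff_deriv_times algebra_simps)

text \<open>
  The remainder of \<open>(\<partial>\<^sub>t + f) P\<close> on division by \<open>\<partial>\<^sub>t\<close> is obtained from that of \<open>P\<close> by applying
  \<open>\<partial>\<^sub>t + f\<close> to each coefficient.
\<close>

lemma intertwining_iff:
  assumes P: "P = A * der_op t + R" and R: "\<forall>\<alpha>\<in>keys R. lookup \<alpha> t = 0"
  shows "(der_op t + fun_op f) \<star> P = Q \<star> der_op t \<longleftrightarrow>
    Q = (der_op t + fun_op f) \<star> A + R \<and> coeff_deriv t R + fun_op f * R = 0"
proof -
  have "\<forall>\<alpha>\<in>keys (coeff_deriv t R + fun_op f * R). lookup \<alpha> t = 0"
    using R by (auto simp: in_keys_iff lookup_add lookup_coeff_deriv lookup_fun_op_times)
  from right_division_unique[OF _ this, of _ Q 0]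
  show ?thesis
    unfolding P op_mult_der_op_right first_order_mult by auto
qed

text \<open>
  The two operators differ by \<open>(\<partial>\<^sub>t + f) A - A \<partial>\<^sub>t\<close>, which has at most the order of \<open>A\<close>, and the quotient
  \<open>A\<close> has smaller order than \<open>P\<close>.
\<close>

lemma symbol_intertwined:
  assumes P: "P = A * der_op t + R" and R: "\<forall>\<alpha>\<in>keys R. lookup \<alpha> t = 0"
  shows "symbol P = symbol ((der_op t + fun_op f) \<star> A + R)"
proof -
  have "P - ((der_op t + fun_op f) \<star> A + R) = 0 - (coeff_deriv t A + fun_op f * A)"
    by (simp add: P op_mult_add_left op_mult_der_op op_mult_fun_op left_der_eq)
  then show ?thesis
    unfolding symbol_eq_iff
    using deg_less_quotient[OF P R]
    by (simp only:) (intro deg_less_diff deg_less_add deg_less_coeff_deriv deg_less_fun_op_times deg_less_0)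
qed

text \<open>
  In \<open>(N - \<partial>\<^sub>t) P = (Q - P) \<partial>\<^sub>t - (\<partial>\<^sub>t P - P \<partial>\<^sub>t)\<close> the right-hand side has at most the order of \<open>P\<close>,
  because \<open>Q - P\<close> has smaller order than \<open>P\<close>. As orders add up, \<open>N - \<partial>\<^sub>t\<close> has order \<open>0\<close>.
\<close>

lemma intertwiner_first_order:
  assumes sym: "symbol P = symbol Q" and "P \<noteq> 0" and eq: "N \<star> P = Q \<star> der_op t"
  obtains f where "N = der_op t + fun_op f"
proof (cases "N - der_op t = 0")
  case True
  then show ?thesis using that[of 0] by simp
next
  case False
  let ?N = "N - der_op t"
  have "deg_less (op_order P) (Q - P)"
    using sym deg_less_diff[OF deg_less_0, of "op_order P" "P - Q"] by (simp add: symbol_eq_iff)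
  then have "deg_less (Suc (op_order P)) ((Q - P) * der_op t - coeff_deriv t P)"
    by (rule deg_less_diff[OF deg_less_times_der_op deg_less_coeff_deriv[OF deg_less_op_order]])
  also have "(Q - P) * der_op t - coeff_deriv t P = ?N \<star> P"
    by (simp add: op_mult_diff_left eq op_mult_der_op_right op_mult_der_op left_der_eq left_diff_distrib)
  finally have less: "deg_less (Suc (op_order P)) (?N \<star> P)" .
  obtain \<delta> where "mdeg \<delta> = op_order ?N + op_order P" "lookup (?N \<star> P) \<delta> \<noteq> 0"
    using False \<open>P \<noteq> 0\<close> by (rule op_mult_top_coefficient)
  with less have "op_order ?N = 0"
    by (metis add_is_0 add_Suc deg_less_def le_add2 not0_implies_Suc nat_add_left_cancel_le plus_1_eq_Suc)
  then have "lookup ?N \<alpha> = 0" if "\<alpha> \<noteq> 0" for \<alpha>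
    using deg_less_op_order[of ?N] that by (auto simp: deg_less_def mdeg_eq_0_iff Suc_le_eq)
  then have "?N = fun_op (lookup ?N 0)"
    by (intro poly_mapping_eqI) (auto simp: fun_op_def lookup_single when_def)
  then have "N = der_op t + fun_op (lookup ?N 0)"
    by (metis add.commute diff_add_cancel)
  then show ?thesis by (rule that)
qed

section \<open>Darboux transformations\<close>

text \<open>
  Conjugation by \<open>\<psi>\<close> moves the kernel function \<open>\<psi>\<close> of \<open>M\<close> to the constant \<open>1\<close>.
\<close>

lemma op_conj_first_order:
  assumes "\<psi> \<noteq> 0"
  shows "op_conj D \<psi> (der_op t - fun_op (D t \<psi> * inverse \<psi>)) = der_op t"
  using assms
  by (simp add: op_conj_diff op_conj_der_op op_conj_fun_op divide_inverse)

lemma darboux_transformation_conj_iff: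
  assumes "\<psi> \<noteq> 0" and "M = der_op t - fun_op (D t \<psi> * inverse \<psi>)"
  shows "darboux_transformation D M N L L1 \<longleftrightarrow>
    symbol (op_conj D \<psi> L) = symbol (op_conj D \<psi> L1) \<and>
    op_conj D \<psi> N \<star> op_conj D \<psi> L = op_conj D \<psi> L1 \<star> der_op t"
  using assms op_conj_inj[OF assms(1), of "N \<star> L" "L1 \<star> M"]
  by (simp add: darboux_transformation_def op_conj_mult symbol_op_conj op_conj_first_order)

lemma t_decomposition_iff:
  "t_decomposition D t P A B c \<longleftrightarrow>
     c \<noteq> 0 \<and> (\<forall>\<alpha>\<in>keys B. lookup \<alpha> t = 0) \<and> coeff_deriv t B = 0 \<and> P = A * der_op t + fun_op c * B"
proof -
  have "coeff_deriv t B = 0 \<longleftrightarrow> (\<forall>\<alpha>. D t (lookup B \<alpha>) = 0)"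
    by (metis lookup_coeff_deriv lookup_zero poly_mapping_eqI)
  also have "\<dots> \<longleftrightarrow> (\<forall>\<alpha>\<in>keys B. D t (lookup B \<alpha>) = 0)"
    by (metis D_0 in_keys_iff)
  finally show ?thesis
    by (auto simp: t_decomposition_def t_free_def op_mult_der_op_right op_mult_fun_op)
qed

lemma keys_fun_op_times: "keys (fun_op f * B) \<subseteq> keys B"
  by (auto simp: in_keys_iff lookup_fun_op_times)

lemma darboux_formulas_iff:
  assumes "c \<noteq> 0" and P: "op_conj D \<psi> L = A * der_op t + R"
  shows "darboux_formulas D t \<psi> L A c N L1 \<longleftrightarrow>
    op_conj D \<psi> N = der_op t + fun_op (- D t c / c) \<and>
    op_conj D \<psi> L1 = (der_op t + fun_op (- D t c / c)) \<star> A + R"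
  unfolding darboux_formulas_def op_conj_reciprocal_der_op[OF assms(1)] P
  by (auto simp: op_mult_der_op_right add.commute)

lemma scaled_remainder_eq:
  assumes "c \<noteq> 0" "coeff_deriv t B = 0"
  shows "coeff_deriv t (fun_op c * B) + fun_op f * (fun_op c * B) = fun_op (D t c + f * c) * B"
  using assms by (simp add: coeff_deriv_times coeff_deriv_fun_op fun_op_add fun_op_mult algebra_simps)

lemma darboux_formulas_imp_intertwining:
  assumes dec: "t_decomposition D t (op_conj D \<psi> L) A B c"
    and form: "darboux_formulas D t \<psi> L A c N L1"
  shows "symbol (op_conj D \<psi> L) = symbol (op_conj D \<psi> L1)"
    and "op_conj D \<psi> N \<star> op_conj D \<psi> L = op_conj D \<psi> L1 \<star> der_op t"
proof -
  from dec have c: "c \<noteq> 0" and B: "\<forall>\<alpha>\<in>keys B. lookup \<alpha> t = 0" "coeff_deriv t B = 0"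
    and P: "op_conj D \<psi> L = A * der_op t + fun_op c * B"
    unfolding t_decomposition_iff by auto
  have R: "\<forall>\<alpha>\<in>keys (fun_op c * B). lookup \<alpha> t = 0"
    using B keys_fun_op_times by blast
  have NL: "op_conj D \<psi> N = der_op t + fun_op (- D t c / c)"
      "op_conj D \<psi> L1 = (der_op t + fun_op (- D t c / c)) \<star> A + fun_op c * B"
    using form darboux_formulas_iff[OF c P] by auto
  show "symbol (op_conj D \<psi> L) = symbol (op_conj D \<psi> L1)"
    unfolding NL by (rule symbol_intertwined[OF P R])
  have "coeff_deriv t (fun_op c * B) + fun_op (- D t c / c) * (fun_op c * B) = 0"
    using scaled_remainder_eq[OF c B(2), of "- D t c / c"] c by simp
  then show "op_conj D \<psi> N \<star> op_conj D \<psi> L = op_conj D \<psi> L1 \<star> der_op t"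
    unfolding NL intertwining_iff[OF P R] by simp
qed

text \<open>
  If \<open>c\<close> solves the first-order equation that every coefficient of \<open>R\<close> solves, then the quotients
  of these coefficients by \<open>c\<close> are constant in \<open>t\<close>.
\<close>

lemma t_decomposition_from_remainder:
  assumes P: "P = A * der_op t + R" and R: "\<forall>\<alpha>\<in>keys R. lookup \<alpha> t = 0"
    and c: "c \<noteq> 0" "D t c = - f * c" and eq: "coeff_deriv t R + fun_op f * R = 0"
  shows "t_decomposition D t P A (fun_op (inverse c) * R) c"
  unfolding t_decomposition_iff
proof (intro conjI)
  show "\<forall>\<alpha>\<in>keys (fun_op (inverse c) * R). lookup \<alpha> t = 0"
    using R keys_fun_op_times by blast
  have "D t (inverse c) = inverse c * f"
    unfolding D_inverse[OF c(1)] c(2) using c(1) by (simp add: power2_eq_square field_simps)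
  then have "coeff_deriv t (fun_op (inverse c) * R) = fun_op (inverse c) * (coeff_deriv t R + fun_op f * R)"
    by (simp add: coeff_deriv_times coeff_deriv_fun_op fun_op_mult algebra_simps)
  with eq show "coeff_deriv t (fun_op (inverse c) * R) = 0" by simp
  have "fun_op c * (fun_op (inverse c) * R) = R"
    using c by (simp flip: fun_op_mult mult.assoc)
  with P show "P = A * der_op t + fun_op c * (fun_op (inverse c) * R)" by simp
qed (rule c)

text \<open>
  The equation holds coefficientwise, so any nonzero coefficient of the remainder serves as \<open>c\<close>.
\<close>

lemma remainder_coefficient_solution:
  assumes "R \<noteq> 0" and eq: "coeff_deriv t R + fun_op f * R = 0"
  obtains c where "c \<noteq> 0" "D t c = - f * c"
proof -
  from assms(1) obtain \<alpha> where \<alpha>: "lookup R \<alpha> \<noteq> 0"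
    by (metis lookup_zero poly_mapping_eqI)
  have "D t (lookup R \<alpha>) + f * lookup R \<alpha> = 0"
    using arg_cong[OF eq, of "\<lambda>P. lookup P \<alpha>"]
    by (simp add: lookup_add lookup_coeff_deriv lookup_fun_op_times)
  then have "D t (lookup R \<alpha>) = - f * lookup R \<alpha>"
    by (simp add: eq_neg_iff_add_eq_0)
  with \<alpha> show ?thesis by (rule that)
qed

text \<open>
  The coefficient \<open>b\<close> of \<open>B\<close> is constant in \<open>t\<close>, so it can be moved from \<open>B\<close> into \<open>c\<close>.
\<close>

lemma t_decomposition_normalize:
  assumes dec: "t_decomposition D t P A B c" and b: "lookup B \<alpha> \<noteq> 0"
  shows "t_decomposition D t P A (fun_op (inverse (lookup B \<alpha>)) * B) (c * lookup B \<alpha>)"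
    and "lookup (fun_op (inverse (lookup B \<alpha>)) * B) \<alpha> = 1"
proof -
  let ?b = "lookup B \<alpha>"
  from dec have c: "c \<noteq> 0" and B: "\<forall>\<alpha>\<in>keys B. lookup \<alpha> t = 0" "coeff_deriv t B = 0"
    and P: "P = A * der_op t + fun_op c * B"
    unfolding t_decomposition_iff by auto
  have "D t ?b = 0"
    using arg_cong[OF B(2), of "\<lambda>P. lookup P \<alpha>"] by (simp add: lookup_coeff_deriv)
  then have "coeff_deriv t (fun_op (inverse ?b) * B) = 0"
    by (simp add: coeff_deriv_times coeff_deriv_fun_op D_inverse[OF b] B(2))
  moreover have "fun_op (c * ?b) * (fun_op (inverse ?b) * B) = fun_op c * B"
    using b by (simp add: mult.assoc flip: fun_op_mult mult.assoc[of "fun_op _"])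
  moreover have "\<forall>\<alpha>\<in>keys (fun_op (inverse ?b) * B). lookup \<alpha> t = 0"
    using B(1) keys_fun_op_times by blast
  ultimately show "t_decomposition D t P A (fun_op (inverse ?b) * B) (c * ?b)"
    using c b P by (simp add: t_decomposition_iff)
  show "lookup (fun_op (inverse ?b) * B) \<alpha> = 1"
    using b by (simp add: lookup_fun_op_times)
qed

end

theorem theorem3p4:
  fixes D :: "'v::finite \<Rightarrow> 'k::field_char_0 \<Rightarrow> 'k"
    and t :: 'v
    and L M :: "('v, 'k) pdo"
    and \<psi> :: 'k
  assumes K: "partial_differential_field D"
    and ker: "\<psi> \<in> op_ker D L"
    and nz: "\<psi> \<noteq> 0"
    and M: "M = der_op t - fun_op (D t \<psi> * inverse \<psi>)"
  shows
    "((\<exists>N L1. darboux_transformation D M N L L1) \<longleftrightarrow>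
       (\<exists>A B c. t_decomposition D t (op_conj D \<psi> L) A B c))
     \<and> (\<forall>A B c \<alpha>. t_decomposition D t (op_conj D \<psi> L) A B c \<and> lookup B \<alpha> \<noteq> 0 \<longrightarrow>
          (\<exists>B' c'. t_decomposition D t (op_conj D \<psi> L) A B' c' \<and> lookup B' \<alpha> = 1))
     \<and> (\<forall>A B c N L1. t_decomposition D t (op_conj D \<psi> L) A B c \<and> darboux_formulas D t \<psi> L A c N L1
          \<longrightarrow> darboux_transformation D M N L L1)
     \<and> (\<forall>A B c N L1. t_decomposition D t (op_conj D \<psi> L) A B c \<and> B \<noteq> 0
            \<and> darboux_transformation D M N L L1
          \<longrightarrow> darboux_formulas D t \<psi> L A c N L1)
     \<and> (has_exponential_solutions D t \<and> L \<noteq> 0 \<longrightarrow>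
          (\<forall>N L1. darboux_transformation D M N L L1 \<longrightarrow>
             (\<exists>A B c. t_decomposition D t (op_conj D \<psi> L) A B c
                \<and> darboux_formulas D t \<psi> L A c N L1)))"
proof -
  interpret partial_differential_field D by (rule K)
  let ?P = "op_conj D \<psi> L"
  note darboux_iff = darboux_transformation_conj_iff[OF nz M]
  have P_0: "?P = 0 \<longleftrightarrow> L = 0"
    using op_conj_inj[OF nz, of L 0] by (simp add: op_conj_def)
  have formulas_imp: "darboux_transformation D M N L L1"
    if "t_decomposition D t ?P A B c" "darboux_formulas D t \<psi> L A c N L1" for A B c N L1
    unfolding darboux_iff using darboux_formulas_imp_intertwining[OF that] by blast
  have intertwining: "\<exists>f A R. op_conj D \<psi> N = der_op t + fun_op f \<and> ?P = A * der_op t + R \<and>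
      (\<forall>\<alpha>\<in>keys R. lookup \<alpha> t = 0) \<and> op_conj D \<psi> L1 = (der_op t + fun_op f) \<star> A + R \<and>
      coeff_deriv t R + fun_op f * R = 0"
    if dt: "darboux_transformation D M N L L1" and L: "L \<noteq> 0" for N L1
  proof -
    have sym: "symbol ?P = symbol (op_conj D \<psi> L1)"
      and eq: "op_conj D \<psi> N \<star> ?P = op_conj D \<psi> L1 \<star> der_op t"
      using dt unfolding darboux_iff by auto
    obtain f where f: "op_conj D \<psi> N = der_op t + fun_op f"
      using sym _ eq by (rule intertwiner_first_order) (use L P_0 in simp)
    obtain A R where AR: "?P = A * der_op t + R" "\<forall>\<alpha>\<in>keys R. lookup \<alpha> t = 0"
      by (rule right_division_by_der_op)
    show ?thesis
      using eq f AR unfolding f intertwining_iff[OF AR] by blast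
  qed
  have decomposition_exists: "\<exists>A B c. t_decomposition D t ?P A B c"
    if dt: "darboux_transformation D M N L L1" for N L1
  proof (cases "L = 0")
    case True
    with P_0 have "t_decomposition D t ?P 0 0 1" by (simp add: t_decomposition_iff)
    then show ?thesis by blast
  next
    case False
    with intertwining[OF dt] obtain f A R where AR: "?P = A * der_op t + R" "\<forall>\<alpha>\<in>keys R. lookup \<alpha> t = 0"
      and eq: "coeff_deriv t R + fun_op f * R = 0"
      by blast
    show ?thesis
    proof (cases "R = 0")
      case True
      \<comment> \<open>There is no coefficient to take \<open>c\<close> from, but with \<open>B = 0\<close> any nonzero \<open>c\<close> will do.\<close>
      with AR have "t_decomposition D t ?P A 0 1" by (simp add: t_decomposition_iff)
      then show ?thesis by blast
    next
      case False
      then obtain c where "c \<noteq> 0" "D t c = - f * c"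
        using eq by (rule remainder_coefficient_solution)
      from t_decomposition_from_remainder[OF AR this eq] show ?thesis by blast
    qed
  qed
  have transformation_exists: "\<exists>N L1. darboux_transformation D M N L L1"
    if dec: "t_decomposition D t ?P A B c" for A B c
  proof -
    from dec have c: "c \<noteq> 0" and P: "?P = A * der_op t + fun_op c * B"
      unfolding t_decomposition_iff by auto
    let ?N = "der_op t + fun_op (- D t c / c)"
    have "darboux_formulas D t \<psi> L A c (op_conj D (inverse \<psi>) ?N)
        (op_conj D (inverse \<psi>) (?N \<star> A + fun_op c * B))"
      unfolding darboux_formulas_iff[OF c P] by (simp add: op_conj_inverse[OF nz])
    from formulas_imp[OF dec this] show ?thesis by blast
  qed
  have formulas_hold: "darboux_formulas D t \<psi> L A c N L1"
    if dec: "t_decomposition D t ?P A B c" and "B \<noteq> 0" and dt: "darboux_transformation D M N L L1"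
    for A B c N L1
  proof -
    from dec have c: "c \<noteq> 0" and B: "\<forall>\<alpha>\<in>keys B. lookup \<alpha> t = 0" "coeff_deriv t B = 0"
      and P: "?P = A * der_op t + fun_op c * B"
      unfolding t_decomposition_iff by auto
    have R: "\<forall>\<alpha>\<in>keys (fun_op c * B). lookup \<alpha> t = 0"
      using B keys_fun_op_times by blast
    obtain \<alpha> where \<alpha>: "lookup B \<alpha> \<noteq> 0"
      using \<open>B \<noteq> 0\<close> by (metis lookup_zero poly_mapping_eqI)
    have "fun_op c * B \<noteq> 0"
      using \<alpha> c lookup_fun_op_times[of c B \<alpha>] by auto
    then have "?P \<noteq> 0"
      using right_division_unique[of A t "fun_op c * B" 0 0] R P by auto
    with intertwining[OF dt] P_0 obtain f A' R' where N: "op_conj D \<psi> N = der_op t + fun_op f"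
      and P': "?P = A' * der_op t + R'" and R': "\<forall>\<alpha>\<in>keys R'. lookup \<alpha> t = 0"
      and L1: "op_conj D \<psi> L1 = (der_op t + fun_op f) \<star> A' + R'"
      and eq: "coeff_deriv t R' + fun_op f * R' = 0"
      by blast
    have AR: "A' = A" "R' = fun_op c * B"
      using right_division_unique[OF _ R' R] P P' by metis+
    have "fun_op (D t c + f * c) * B = 0"
      using eq scaled_remainder_eq[OF c B(2), of f] by (simp add: AR)
    then have "(D t c + f * c) * lookup B \<alpha> = 0"
      by (metis lookup_fun_op_times lookup_zero)
    with \<alpha> have "D t c + f * c = 0" by simp
    with c have "f = - D t c / c"
      by (simp add: field_simps eq_neg_iff_add_eq_0)
    with N L1 AR show ?thesis
      unfolding darboux_formulas_iff[OF c P] by simp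
  qed
  have formulas_exist: "\<exists>A B c. t_decomposition D t ?P A B c \<and> darboux_formulas D t \<psi> L A c N L1"
    if exp: "has_exponential_solutions D t" and "L \<noteq> 0" and dt: "darboux_transformation D M N L L1"
    for N L1
  proof -
    from intertwining[OF dt \<open>L \<noteq> 0\<close>] obtain f A R where N: "op_conj D \<psi> N = der_op t + fun_op f"
      and AR: "?P = A * der_op t + R" "\<forall>\<alpha>\<in>keys R. lookup \<alpha> t = 0"
      and L1: "op_conj D \<psi> L1 = (der_op t + fun_op f) \<star> A + R"
      and eq: "coeff_deriv t R + fun_op f * R = 0"
      by blast
    obtain c where c: "c \<noteq> 0" "D t c = - f * c"
      using exp unfolding has_exponential_solutions_def by blast
    then have "f = - D t c / c" by simp
    with N L1 have "darboux_formulas D t \<psi> L A c N L1"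
      unfolding darboux_formulas_iff[OF c(1) AR(1)] by simp
    with t_decomposition_from_remainder[OF AR c eq] show ?thesis by blast
  qed
  have normalized: "\<exists>B' c'. t_decomposition D t ?P A B' c' \<and> lookup B' \<alpha> = 1"
    if "t_decomposition D t ?P A B c" "lookup B \<alpha> \<noteq> 0" for A B c \<alpha>
    using t_decomposition_normalize[OF that] by (intro exI conjI)
  show ?thesis
  proof (intro conjI allI impI; (elim conjE)?)
    show "(\<exists>N L1. darboux_transformation D M N L L1) \<longleftrightarrow> (\<exists>A B c. t_decomposition D t ?P A B c)"
      using decomposition_exists transformation_exists by (intro iffI; elim exE)
  qed ((fact normalized formulas_imp formulas_hold)+, rule formulas_exist)
qed

end
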